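(* Let $\mathbb{T}$ be a triangulation of the infinite strip $\mathcal{B}_\infty$. Then $\mathbb{T}$ is compact if and only if it contains some connecting arcs and every marked point in $\mathcal{B}_\infty$ is either $\mathbb{T}$-bounded or an endpoint of infinitely many connecting arcs of $\mathbb{T}$.
   Context: $\mathcal{B}_\infty=\{(x,y)\in\mathbb{R}^2: 0\le y\le 1\}$. The marked points are the upper marked points $\mathfrak{l}_i=(i,1)$ and the lower marked points $\mathfrak{r}_i=(-i,0)$, $i\in\mathbb{Z}$. A simple curve is a curve in $\mathcal{B}_\infty$ joining two marked points, not crossing itself and meeting the boundary lines only at its endpoints. For distinct marked points $\mathfrak{p},\mathfrak{q}$ there is a unique isotopy class $[\mathfrak{p},\mathfrak{q}]=[\mathfrak{q},\mathfrak{p}]$ of simple curves joining them. It is called an arc unless $\{\mathfrak{p},\mathfrak{q}\}=\{\mathfrak{l}_i,\mathfrak{l}_{i+1}\}$ or $\{\mathfrak{r}_i,\mathfrak{r}_{i+1}\}$ for some $i$. An arc is upper (lower) if both endpoints are upper (lower) marked points, and connecting otherwise. Two curves cross if they intersect in a point which is not an endpoint of any of the two curves; two arcs $u,v$ cross if every curve in $u$ crosses every curve in $v$. Equivalently: upper and lower arcs never cross; $[\mathfrak{l}_i,\mathfrak{l}_j]$ ($i<j$) crosses $[\mathfrak{l}_r,\mathfrak{r}_s]$ iff $i<r<j$; $[\mathfrak{r}_i,\mathfrak{r}_j]$ ($i>j$) crosses $[\mathfrak{l}_r,\mathfrak{r}_s]$ iff $i>s>j$; $[\mathfrak{l}_i,\mathfrak{r}_j]$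 and $[\mathfrak{l}_p,\mathfrak{r}_q]$ cross iff ($i>p$ and $j>q$) or ($i<p$ and $j<q$); $[\mathfrak{l}_i,\mathfrak{l}_j]$, $[\mathfrak{l}_p,\mathfrak{l}_q]$ ($i<j$, $p<q$) cross iff $i<p<j<q$ or $p<i<q<j$; and likewise $[\mathfrak{r}_i,\mathfrak{r}_j]$, $[\mathfrak{r}_p,\mathfrak{r}_q]$ ($i>j$, $p>q$) cross iff $i>p>j>q$ or $p>i>q>j$. The translation $\tau$ is the bijection on arcs which adds $1$ to the index of each endpoint ($\mathfrak{l}_i\mapsto\mathfrak{l}_{i+1}$, $\mathfrak{r}_j\mapsto\mathfrak{r}_{j+1}$); $\tau^-$ is its inverse. For a set $\Sigma$ of arcs, $\tau\Sigma=\{\tau u:u\in\Sigma\}$ and $\tau^-\Sigma=\{\tau^-u:u\in\Sigma\}$. A triangulation of $\mathcal{B}_\infty$ is a maximal set of pairwise non-crossing arcs. A set $\Delta$ of arcs is compact if it has a finite subset $\Sigma$ such that every arc in $\Delta$ crosses some arc of $\tau\Sigma$ and some arc of $\tau^-\Sigma$. For a triangulation $\mathbb{T}$ and an arc $u$, $\mathbb{T}_u$ is the set of arcs of $\mathbb{T}$ which cross $u$; $\mathbb{T}$ is compact if $\mathbb{T}_u$ is compact for every arc $u$ in $\mathcal{B}_\infty$. A marked point is $\mathbb{T}$-bounded if it is an endpoint of at most finitely many arcs of $\mathbb{T}$. *)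

theory Defs
  imports "HOL-Analysis.Analysis"
begin

definition strip :: "(real^2) set" where
  "strip = {z. 0 \<le> z$2 \<and> z$2 \<le> 1}"

definition boundary_lines :: "(real^2) set" where
  "boundary_lines = {z. z$2 = 0 \<or> z$2 = 1}"

datatype marked_point = Upper int | Lower int

text \<open>The lower marked points are numbered from right to left.\<close>

fun position :: "marked_point \<Rightarrow> real^2" where
  "position (Upper i) = vector [of_int i, 1]"
| "position (Lower i) = vector [- of_int i, 0]"

text \<open>
  Simple curves joining two distinct marked points are exactly one isotopy class, so the class
  \<open>[p, q] = [q, p]\<close> is represented by the unordered pair \<open>{p, q}\<close>, and its members are all the
  simple curves, of either orientation, joining \<open>p\<close> and \<open>q\<close>. The predicate \<^const>\<open>arc\<close> of the
  library means an injective path; the arcs of the strip are called \<open>strip_arcs\<close> below.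
\<close>

definition simple_curves :: "marked_point set \<Rightarrow> (real \<Rightarrow> real^2) set" where
  "simple_curves u =
    {g. arc g \<and> path_image g \<subseteq> strip \<and>
        {pathstart g, pathfinish g} = position ` u \<and>
        path_image g \<inter> boundary_lines = {pathstart g, pathfinish g}}"

definition strip_arcs :: "marked_point set set" where
  "strip_arcs =
    {{p, q} | p q. p \<noteq> q \<and>
      \<not> (\<exists>i. {p, q} = {Upper i, Upper (i + 1)} \<or> {p, q} = {Lower i, Lower (i + 1)})}"

definition upper_arc :: "marked_point set \<Rightarrow> bool" where
  "upper_arc u \<longleftrightarrow> u \<in> strip_arcs \<and> u \<subseteq> range Upper"

definition lower_arc :: "marked_point set \<Rightarrow> bool" where
  "lower_arc u \<longleftrightarrow> u \<in> strip_arcs \<and> u \<subseteq> range Lower"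

definition connecting_arc :: "marked_point set \<Rightarrow> bool" where
  "connecting_arc u \<longleftrightarrow> u \<in> strip_arcs \<and> \<not> upper_arc u \<and> \<not> lower_arc u"

definition curves_cross :: "(real \<Rightarrow> real^2) \<Rightarrow> (real \<Rightarrow> real^2) \<Rightarrow> bool" where
  "curves_cross g h \<longleftrightarrow>
    (\<exists>z \<in> path_image g \<inter> path_image h.
       z \<notin> {pathstart g, pathfinish g} \<and> z \<notin> {pathstart h, pathfinish h})"

definition arcs_cross :: "marked_point set \<Rightarrow> marked_point set \<Rightarrow> bool" where
  "arcs_cross u v \<longleftrightarrow>
    (\<forall>g \<in> simple_curves u. \<forall>h \<in> simple_curves v. curves_cross g h)"

fun shift_point :: "int \<Rightarrow> marked_point \<Rightarrow> marked_point" where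
  "shift_point k (Upper i) = Upper (i + k)"
| "shift_point k (Lower i) = Lower (i + k)"

definition translation :: "marked_point set \<Rightarrow> marked_point set" where
  "translation u = shift_point 1 ` u"

definition inverse_translation :: "marked_point set \<Rightarrow> marked_point set" where
  "inverse_translation u = shift_point (- 1) ` u"

definition noncrossing_arcs :: "marked_point set set \<Rightarrow> bool" where
  "noncrossing_arcs T \<longleftrightarrow> T \<subseteq> strip_arcs \<and> pairwise (\<lambda>u v. \<not> arcs_cross u v) T"

definition strip_triangulation :: "marked_point set set \<Rightarrow> bool" where
  "strip_triangulation T \<longleftrightarrow>
    noncrossing_arcs T \<and> (\<forall>T'. noncrossing_arcs T' \<and> T \<subseteq> T' \<longrightarrow> T' = T)"

definition compact_arcs :: "marked_point set set \<Rightarrow> bool" where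
  "compact_arcs D \<longleftrightarrow>
    (\<exists>S \<subseteq> D. finite S \<and>
       (\<forall>u \<in> D. (\<exists>v \<in> translation ` S. arcs_cross u v) \<and>
                 (\<exists>v \<in> inverse_translation ` S. arcs_cross u v)))"

definition arcs_crossing :: "marked_point set set \<Rightarrow> marked_point set \<Rightarrow> marked_point set set" where
  "arcs_crossing T u = {v \<in> T. arcs_cross v u}"

definition compact_triangulation :: "marked_point set set \<Rightarrow> bool" where
  "compact_triangulation T \<longleftrightarrow>
    strip_triangulation T \<and> (\<forall>u \<in> strip_arcs. compact_arcs (arcs_crossing T u))"

definition bounded_point :: "marked_point set set \<Rightarrow> marked_point \<Rightarrow> bool" where
  "bounded_point T p \<longleftrightarrow> finite {u \<in> T. p \<in> u}"

end

theory Submission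
  imports Defs
begin

text \<open>
  By the Fashoda meet theorem two arcs cross if their endpoints interleave on the boundary; otherwise
  segments and flat parabolas give curves that do not cross.

  Write \<open>T\<^sub>u\<close> for the arcs of \<open>T\<close> crossing \<open>u\<close>. Once \<open>T\<close> has a connecting arc, \<open>T\<^sub>u\<close> is contained in
  finitely many stars, and each star splits into a right and a left fan. If every unbounded point
  carries infinitely many connecting arcs, then the upper arcs \<open>[l\<^sub>k, l\<^sub>b]\<close>, \<open>b > k\<close>, of a right fan
  are unbounded to the right exactly if its connecting arcs \<open>[l\<^sub>k, r\<^sub>q]\<close> are. Far enough to the right
  both kinds cross \<open>u\<close> or neither does, so \<open>T\<^sub>u\<close> contains one arc of each kind or only finitely many
  arcs of the fan; the inverse translate of an upper arc together with the translate of a connecting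
  arc crosses all arcs further to the right. Conversely, if infinitely many
  \<open>[l\<^sub>k, l\<^sub>b]\<close>, \<open>b > k\<close>, but only finitely many connecting arcs of \<open>T\<close> end at \<open>l\<^sub>k\<close>, compactness fails
  for \<open>u = [l\<^bsub>k+1\<^esub>, r\<^sub>s]\<close> with \<open>s\<close> so small that no connecting arc of \<open>T\<close> at \<open>l\<^sub>k\<close> crosses \<open>u\<close>.
  And if \<open>T\<close> has no connecting arc, compactness yields a largest arc over any marked point; its left
  end is not covered, so maximality forces a connecting arc between two uncovered points.
\<close>

subsection \<open>Crossing of arcs\<close>

lemma position_eq_iff [simp]: "position p = position q \<longleftrightarrow> p = q"
  by (cases p; cases q) (auto simp: vec_eq_iff forall_2)

lemma position_coords [simp]:
  "position (Upper i) $ 1 = of_int i" "position (Upper i) $ 2 = 1"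
  "position (Lower i) $ 1 = - of_int i" "position (Lower i) $ 2 = 0"
  by simp_all

lemma arcs_cross_commute: "arcs_cross u v \<longleftrightarrow> arcs_cross v u"
  unfolding arcs_cross_def curves_cross_def by blast

text \<open>An arc is an unordered pair, so a representative may run either way. Reversing it yields
  a path with the prescribed start and the same image, as the Fashoda theorems require.\<close>

lemma simple_curve_path:
  assumes "g \<in> simple_curves {p, q}"
  obtains g' where "path g'" "path_image g' = path_image g"
    "pathstart g' = position p" "pathfinish g' = position q"
    "path_image g \<subseteq> strip" "path_image g \<inter> boundary_lines = {position p, position q}"
proof -
  from assms have g: "arc g" "path_image g \<subseteq> strip" "{pathstart g, pathfinish g} = {position p, position q}"
    "path_image g \<inter> boundary_lines = {position p, position q}"
    unfolding simple_curves_def by auto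
  consider "pathstart g = position p" "pathfinish g = position q"
    | "pathstart g = position q" "pathfinish g = position p"
    using g(3) by (auto simp: doubleton_eq_iff)
  then show thesis
  proof cases
    case 1 then show ?thesis using that[of g] g by (auto dest: arc_imp_path)
  next
    case 2 then show ?thesis using that[of "reversepath g"] g by (auto dest: arc_imp_path)
  qed
qed

lemma path_images_bounded:
  fixes f g :: "real \<Rightarrow> real^2"
  assumes "path f" "path g"
  obtains M where "\<And>z. z \<in> path_image f \<union> path_image g \<Longrightarrow> \<bar>z $ 1\<bar> \<le> M"
proof -
  have "bounded (path_image f \<union> path_image g)" using assms by (simp add: bounded_path_image)
  then obtain M where "\<forall>z \<in> path_image f \<union> path_image g. norm z \<le> M" unfolding bounded_iff by blast
  then show thesis using that[of M] by (meson component_le_norm_cart order_trans)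
qed

text \<open>A simple curve touches the boundary lines only at its ends. If the arcs share no marked
  point, a common point is off these lines, hence an end of neither curve.\<close>

lemma curves_cross_if_meet:
  assumes f: "f \<in> simple_curves {p, q}" and g: "g \<in> simple_curves {p', q'}"
    and dis: "{p, q} \<inter> {p', q'} = {}" and z: "z \<in> path_image f" "z \<in> path_image g"
  shows "curves_cross f g"
proof -
  have e: "{pathstart f, pathfinish f} = {position p, position q}"
    "{pathstart g, pathfinish g} = {position p', position q'}"
    "path_image f \<inter> boundary_lines = {position p, position q}"
    "path_image g \<inter> boundary_lines = {position p', position q'}"
    using f g unfolding simple_curves_def by auto
  have "z \<notin> boundary_lines"
  proof
    assume "z \<in> boundary_lines"
    then have "z \<in> {position p, position q}" "z \<in> {position p', position q'}" using e z by blast+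
    then show False using dis by auto
  qed
  then show ?thesis unfolding curves_cross_def using z e by blast
qed

lemma in_strip_cbox:
  assumes "S \<subseteq> strip" "\<And>z. z \<in> S \<Longrightarrow> \<bar>z $ 1\<bar> \<le> M"
  shows "S \<subseteq> cbox (vector [-M, 0]) (vector [M, 1])"
  using assms unfolding strip_def by (force simp: mem_box_cart forall_2)

section \<open>Interleaved ends force crossing\<close>

lemma lower_lower_cross:
  assumes "p < r" "r < q" "q < s"
  shows "arcs_cross {Lower p, Lower q} {Lower r, Lower s}"
  unfolding arcs_cross_def
proof (intro ballI)
  fix f g assume f: "f \<in> simple_curves {Lower p, Lower q}" and g: "g \<in> simple_curves {Lower r, Lower s}"
  \<comment> \<open>Lower indices grow from right to left, while \<open>fashoda_interlace\<close>
    orders the ends from left to right; so both curves run from the larger index to the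
    smaller.\<close>
  have f': "f \<in> simple_curves {Lower q, Lower p}" and g': "g \<in> simple_curves {Lower s, Lower r}"
    using f g by (simp_all add: insert_commute)
  obtain F where F: "path F" "path_image F = path_image f" "pathstart F = position (Lower q)"
    "pathfinish F = position (Lower p)" "path_image f \<subseteq> strip"
    by (rule simple_curve_path[OF f'])
  obtain G where G: "path G" "path_image G = path_image g" "pathstart G = position (Lower s)"
    "pathfinish G = position (Lower r)" "path_image g \<subseteq> strip"
    by (rule simple_curve_path[OF g'])
  obtain M where M: "\<And>z. z \<in> path_image F \<union> path_image G \<Longrightarrow> \<bar>z $ 1\<bar> \<le> M"
    using path_images_bounded[OF F(1) G(1)] by blast
  obtain z where "z \<in> path_image G" "z \<in> path_image F"
  proof (rule fashoda_interlace[OF G(1) F(1)])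
    show "path_image G \<subseteq> cbox (vector [-M, 0]) (vector [M, 1])"
      "path_image F \<subseteq> cbox (vector [-M, 0]) (vector [M, 1])"
      using F G M by (intro in_strip_cbox; auto)+
  qed (use assms F G in auto)
  then show "curves_cross f g"
    using curves_cross_if_meet[OF f g] F G assms by auto
qed

lemma lower_connecting_cross:
  assumes "p < s" "s < q"
  shows "arcs_cross {Lower p, Lower q} {Upper r, Lower s}"
  unfolding arcs_cross_def
proof (intro ballI)
  fix f g assume f: "f \<in> simple_curves {Lower p, Lower q}" and g: "g \<in> simple_curves {Upper r, Lower s}"
  have f': "f \<in> simple_curves {Lower q, Lower p}" and g': "g \<in> simple_curves {Lower s, Upper r}"
    using f g by (simp_all add: insert_commute)
  obtain F where F: "path F" "path_image F = path_image f" "pathstart F = position (Lower q)"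
    "pathfinish F = position (Lower p)" "path_image f \<subseteq> strip"
    "path_image f \<inter> boundary_lines = {position (Lower q), position (Lower p)}"
    by (rule simple_curve_path[OF f'])
  obtain G where G: "path G" "path_image G = path_image g" "pathstart G = position (Lower s)"
    "pathfinish G = position (Upper r)" "path_image g \<subseteq> strip"
    by (rule simple_curve_path[OF g'])
  obtain M where M: "\<And>z. z \<in> path_image F \<union> path_image G \<Longrightarrow> \<bar>z $ 1\<bar> \<le> M"
    using path_images_bounded[OF F(1) G(1)] by blast
  have Mpos: "0 \<le> M" using M[of "pathstart F"] by fastforce
  have Mr: "\<bar>real_of_int r\<bar> \<le> M" using M[of "pathfinish G"] G(4) by fastforce
  have Mp: "\<bar>real_of_int p\<bar> \<le> M" using M[of "pathfinish F"] F(4) by fastforce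
  let ?c = "vector [M + 1, 1] :: real^2" and ?d = "vector [M + 1, 0] :: real^2"
  \<comment> \<open>Lead \<open>g\<close> back to the lower boundary line on the far right, where \<open>f\<close> does not reach.\<close>
  define H where "H = G +++ (linepath (position (Upper r)) ?c +++ linepath ?c ?d)"
  have H: "path H" "pathstart H = position (Lower s)" "pathfinish H = ?d"
    "path_image H = path_image G \<union> (closed_segment (position (Upper r)) ?c \<union> closed_segment ?c ?d)"
    unfolding H_def using G by (auto simp: path_image_join)
  have seg1: "z $ 2 = 1 \<and> \<bar>z $ 1\<bar> \<le> M + 1" if "z \<in> closed_segment (position (Upper r)) ?c" for z
    using that Mr Mpos by (subst (asm) segment_horizontal) auto
  have seg2: "z $ 1 = M + 1 \<and> 0 \<le> z $ 2 \<and> z $ 2 \<le> 1" if "z \<in> closed_segment ?c ?d" for z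
    using that by (subst (asm) segment_vertical) auto
  obtain z where z: "z \<in> path_image F" "z \<in> path_image H"
  proof (rule fashoda_interlace[OF F(1) H(1)])
    show "path_image F \<subseteq> cbox (vector [-(M+1), 0]) (vector [M+1, 1])"
      using F M by (intro in_strip_cbox) (fastforce intro: order_trans)+
    show "path_image H \<subseteq> cbox (vector [-(M+1), 0]) (vector [M+1, 1])"
    proof (rule in_strip_cbox)
      show "path_image H \<subseteq> strip" unfolding H(4) using G(2,5) seg1 seg2 by (auto simp: strip_def)
      show "\<bar>z $ 1\<bar> \<le> M + 1" if "z \<in> path_image H" for z
        using that seg1 seg2 Mpos M unfolding H(4) by fastforce
    qed
  qed (use assms F H Mp in auto)
  \<comment> \<open>The common point is not on the added pieces: \<open>f\<close> never reaches the
    upper boundary line, and the vertical piece lies beyond the bound \<open>M\<close>.\<close>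
  have "z \<notin> closed_segment (position (Upper r)) ?c"
  proof
    assume "z \<in> closed_segment (position (Upper r)) ?c"
    then have "z $ 2 = 1" using seg1 by blast
    then have "z \<in> {position (Lower q), position (Lower p)}" using F z(1) by (auto simp: boundary_lines_def)
    then show False using \<open>z $ 2 = 1\<close> by auto
  qed
  moreover have "z \<notin> closed_segment ?c ?d" using seg2 M[of z] z(1) by force
  ultimately have "z \<in> path_image G" using z H(4) by blast
  then show "curves_cross f g"
    using curves_cross_if_meet[OF f g] F G z assms by auto
qed

lemma connecting_connecting_cross:
  assumes "i < p" "j < q"
  shows "arcs_cross {Upper i, Lower j} {Upper p, Lower q}"
  unfolding arcs_cross_def
proof (intro ballI)
  fix f g assume f: "f \<in> simple_curves {Upper i, Lower j}" and g: "g \<in> simple_curves {Upper p, Lower q}"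
  have f': "f \<in> simple_curves {Lower j, Upper i}" and g': "g \<in> simple_curves {Lower q, Upper p}"
    using f g by (simp_all add: insert_commute)
  obtain F where F: "path F" "path_image F = path_image f" "pathstart F = position (Lower j)"
    "pathfinish F = position (Upper i)" "path_image f \<subseteq> strip"
    "path_image f \<inter> boundary_lines = {position (Lower j), position (Upper i)}"
    by (rule simple_curve_path[OF f'])
  obtain G where G: "path G" "path_image G = path_image g" "pathstart G = position (Lower q)"
    "pathfinish G = position (Upper p)" "path_image g \<subseteq> strip"
    by (rule simple_curve_path[OF g'])
  obtain M where M: "\<And>z. z \<in> path_image F \<union> path_image G \<Longrightarrow> \<bar>z $ 1\<bar> \<le> M"
    using path_images_bounded[OF F(1) G(1)] by blast
  have Mp: "\<bar>real_of_int p\<bar> \<le> M" using M[of "pathfinish G"] G(4) by fastforce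
  have Mq: "\<bar>real_of_int q\<bar> \<le> M" using M[of "pathstart G"] G(3) by fastforce
  let ?a = "vector [-M, 0] :: real^2" and ?b = "vector [M, 1] :: real^2"
  \<comment> \<open>Extend \<open>g\<close> along the boundary lines to a path joining opposite corners of a rectangle.\<close>
  define H where "H = linepath ?a (position (Lower q)) +++ (G +++ linepath (position (Upper p)) ?b)"
  have H: "path H" "pathstart H = ?a" "pathfinish H = ?b"
    "path_image H = closed_segment ?a (position (Lower q)) \<union> (path_image G \<union> closed_segment (position (Upper p)) ?b)"
    unfolding H_def using G by (auto simp: path_image_join)
  have seg1: "z $ 2 = 0 \<and> -M \<le> z $ 1 \<and> z $ 1 \<le> - real_of_int q" if "z \<in> closed_segment ?a (position (Lower q))" for z
    using that Mq by (subst (asm) segment_horizontal) auto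
  have seg2: "z $ 2 = 1 \<and> real_of_int p \<le> z $ 1 \<and> z $ 1 \<le> M" if "z \<in> closed_segment (position (Upper p)) ?b" for z
    using that Mp by (subst (asm) segment_horizontal) auto
  obtain z where z: "z \<in> path_image H" "z \<in> path_image F"
  proof (rule fashoda[OF H(1) F(1)])
    show "path_image F \<subseteq> cbox ?a ?b" using F M by (intro in_strip_cbox) auto
    show "path_image H \<subseteq> cbox ?a ?b"
    proof (rule in_strip_cbox)
      show "path_image H \<subseteq> strip" unfolding H(4) using G(2,5) seg1 seg2 by (auto simp: strip_def)
      show "\<bar>z $ 1\<bar> \<le> M" if "z \<in> path_image H" for z
        using that seg1[of z] seg2[of z] Mp Mq M[of z] unfolding H(4) by (auto simp: abs_le_iff)
    qed
  qed (use F H in auto)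
  \<comment> \<open>On the boundary lines \<open>f\<close> has only its two ends. By
    \<open>j < q\<close> and \<open>i < p\<close> these lie to the right of the lower added segment
    and to the left of the upper one.\<close>
  have "z \<in> {position (Lower j), position (Upper i)}" if "z $ 2 = 0 \<or> z $ 2 = 1"
    using F z that by (auto simp: boundary_lines_def)
  then have "z \<notin> closed_segment ?a (position (Lower q))" "z \<notin> closed_segment (position (Upper p)) ?b"
    using seg1[of z] seg2[of z] assms by auto
  then have "z \<in> path_image G" using z H(4) by blast
  then show "curves_cross f g"
    using curves_cross_if_meet[OF f g] F G z assms by auto
qed

section \<open>The half turn about the point (0, 1/2)\<close>

definition half_turn :: "real^2 \<Rightarrow> real^2" where
  "half_turn z = vector [- (z $ 1), 1 - z $ 2]"

fun opposite :: "marked_point \<Rightarrow> marked_point" where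
  "opposite (Upper i) = Lower i"
| "opposite (Lower i) = Upper i"

lemma opposite_opposite [simp]: "opposite (opposite p) = p"
  by (cases p) auto

lemma half_turn_coords [simp]: "half_turn z $ 1 = - (z $ 1)" "half_turn z $ 2 = 1 - z $ 2"
  by (simp_all add: half_turn_def)

lemma half_turn_half_turn [simp]: "half_turn (half_turn z) = z"
  by (simp add: vec_eq_iff forall_2)

lemma inj_half_turn: "inj half_turn"
  by (metis half_turn_half_turn injI)

lemma half_turn_position: "half_turn (position p) = position (opposite p)"
  by (cases p) (auto simp: vec_eq_iff forall_2)

lemma continuous_on_vector2:
  fixes f g :: "'a::topological_space \<Rightarrow> real"
  assumes "continuous_on S f" "continuous_on S g"
  shows "continuous_on S (\<lambda>t. vector [f t, g t] :: real^2)"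
proof -
  have eq: "(\<lambda>t. vector [f t, g t] :: real^2) = (\<lambda>t. \<chi> k. if k = 1 then f t else g t)"
    by (auto simp: vec_eq_iff forall_2)
  have "continuous_on S (\<lambda>t. if k = 1 then f t else g t)" for k :: 2
    using assms by (cases "k = 1") auto
  then show ?thesis unfolding eq by (rule continuous_on_vec_lambda)
qed

lemma continuous_on_half_turn: "continuous_on S half_turn"
  unfolding half_turn_def[abs_def] by (intro continuous_on_vector2 continuous_intros)

lemma half_turn_simple_curves:
  assumes "g \<in> simple_curves u"
  shows "half_turn \<circ> g \<in> simple_curves (opposite ` u)"
proof -
  from assms have g: "arc g" "path_image g \<subseteq> strip" "{pathstart g, pathfinish g} = position ` u"
    "path_image g \<inter> boundary_lines = {pathstart g, pathfinish g}"
    unfolding simple_curves_def by auto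
  have bd: "half_turn z \<in> boundary_lines \<longleftrightarrow> z \<in> boundary_lines" for z
    by (auto simp: boundary_lines_def)
  have "arc (half_turn \<circ> g)"
    using g(1) inj_half_turn continuous_on_half_turn unfolding arc_def path_def
    by (blast intro: continuous_on_compose comp_inj_on inj_on_subset)
  moreover have "path_image (half_turn \<circ> g) \<subseteq> strip"
    using g(2) by (auto simp: path_image_compose strip_def)
  moreover have "{pathstart (half_turn \<circ> g), pathfinish (half_turn \<circ> g)} = half_turn ` (position ` u)"
    unfolding g(3)[symmetric] by (simp add: pathstart_compose pathfinish_compose)
  moreover have "half_turn ` (position ` u) = position ` (opposite ` u)"
    by (simp add: image_image half_turn_position)
  moreover have "path_image (half_turn \<circ> g) \<inter> boundary_lines = half_turn ` (path_image g \<inter> boundary_lines)"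
    using bd by (auto simp: path_image_compose)
  ultimately show ?thesis
    unfolding simple_curves_def using g(4) by (simp add: pathstart_compose pathfinish_compose)
qed

lemma half_turn_curves_cross:
  "curves_cross (half_turn \<circ> g) (half_turn \<circ> h) \<longleftrightarrow> curves_cross g h"
  unfolding curves_cross_def path_image_compose pathstart_compose pathfinish_compose
    image_Int[OF inj_half_turn, symmetric]
  by (auto simp: inj_eq[OF inj_half_turn])

lemma arcs_cross_opposite:
  "arcs_cross (opposite ` u) (opposite ` v) \<longleftrightarrow> arcs_cross u v"
proof -
  \<comment> \<open>One implication for all arcs suffices, because \<open>opposite\<close> is an
    involution.\<close>
  have *: "arcs_cross u v" if "arcs_cross (opposite ` u) (opposite ` v)" for u v
    unfolding arcs_cross_def
    using that half_turn_simple_curves half_turn_curves_cross unfolding arcs_cross_def by blast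
  show ?thesis using *[of u v] *[of "opposite ` u" "opposite ` v"]
    by (auto simp: image_image)
qed

section \<open>Explicit curves and arcs that do not cross\<close>

text \<open>The parameter \<open>c\<close> bends the segment, which separates two curves of the same arc.\<close>

definition connecting_curve :: "int \<Rightarrow> int \<Rightarrow> real \<Rightarrow> real \<Rightarrow> real^2" where
  "connecting_curve i j c t = vector [- of_int j + t * (of_int i + of_int j) + c * (t * (1 - t)), t]"

text \<open>The parabola \<open>y = 1 - e (x - i) (j - x)\<close>.\<close>

definition upper_curve :: "int \<Rightarrow> int \<Rightarrow> real \<Rightarrow> real \<Rightarrow> real^2" where
  "upper_curve i j e t = vector [of_int i + t * (of_int j - of_int i),
     1 - e * (t * (of_int j - of_int i)) * ((1 - t) * (of_int j - of_int i))]"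

lemma connecting_curve_coords [simp]:
  "connecting_curve i j c t $ 1 = - of_int j + t * (of_int i + of_int j) + c * (t * (1 - t))"
  "connecting_curve i j c t $ 2 = t"
  by (simp_all add: connecting_curve_def)

lemma upper_curve_coords [simp]:
  "upper_curve i j e t $ 1 = of_int i + t * (of_int j - of_int i)"
  "upper_curve i j e t $ 2 = 1 - e * (t * (of_int j - of_int i)) * ((1 - t) * (of_int j - of_int i))"
  by (simp_all add: upper_curve_def)

lemma connecting_curve_ends:
  "connecting_curve i j c 0 = position (Lower j)" "connecting_curve i j c 1 = position (Upper i)"
  by (auto simp: vec_eq_iff forall_2)

lemma upper_curve_ends:
  "upper_curve i j e 0 = position (Upper i)" "upper_curve i j e 1 = position (Upper j)"
  by (auto simp: vec_eq_iff forall_2)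

text \<open>The height of a point is its parameter. This gives injectivity and leaves only the two
  ends on the boundary lines.\<close>

lemma connecting_curve_simple: "connecting_curve i j c \<in> simple_curves {Upper i, Lower j}"
proof -
  have "inj_on (connecting_curve i j c) {0..1}"
    by (rule inj_onI) (metis connecting_curve_coords(2))
  moreover have "path (connecting_curve i j c)"
    unfolding path_def connecting_curve_def[abs_def] by (intro continuous_on_vector2 continuous_intros)
  moreover have "z = connecting_curve i j c (z $ 2) \<and> 0 \<le> z $ 2 \<and> z $ 2 \<le> 1"
    if "z \<in> path_image (connecting_curve i j c)" for z
    using that by (auto simp: path_image_def)
  moreover have "z = position (Lower j) \<or> z = position (Upper i)"
    if "z = connecting_curve i j c (z $ 2)" "z \<in> boundary_lines" for z
    using that connecting_curve_ends[of i j c] unfolding boundary_lines_def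
    by (metis (mono_tags, lifting) mem_Collect_eq)
  moreover have "position (Lower j) \<in> boundary_lines" "position (Upper i) \<in> boundary_lines"
    by (simp_all add: boundary_lines_def del: position.simps)
  moreover have "position (Lower j) \<in> path_image (connecting_curve i j c)"
    "position (Upper i) \<in> path_image (connecting_curve i j c)"
    using connecting_curve_ends[of i j c, symmetric] by (auto simp: path_image_def del: position.simps)
  ultimately show ?thesis
    unfolding simple_curves_def arc_def strip_def pathstart_def pathfinish_def
    by (auto simp: connecting_curve_ends simp del: position.simps)
qed

lemma upper_curve_image:
  assumes "i < j" "z \<in> path_image (upper_curve i j e)"
  shows "z $ 2 = 1 - e * (z $ 1 - of_int i) * (of_int j - z $ 1)"
    "of_int i \<le> z $ 1" "z $ 1 \<le> of_int j"
proof -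
  from assms(2) obtain t where t: "0 \<le> t" "t \<le> 1" "z = upper_curve i j e t"
    by (auto simp: path_image_def)
  then show "z $ 2 = 1 - e * (z $ 1 - of_int i) * (of_int j - z $ 1)"
    by (simp add: algebra_simps)
  show "of_int i \<le> z $ 1" using t assms(1) by simp
  have "t * (of_int j - of_int i) \<le> 1 * (of_int j - of_int i)"
    using t assms(1) by (intro mult_right_mono) auto
  then show "z $ 1 \<le> of_int j" using t by simp
qed

text \<open>Since \<open>t * (1 - t)\<close> is at most 1/4, a flat parabola stays above the middle
  line. This keeps it off the lower boundary line and away from half-turned parabolas.\<close>

lemma upper_curve_depth:
  assumes "i < j" "0 < e" "e * (of_int j - of_int i)\<^sup>2 \<le> 1" "0 \<le> t" "t \<le> 1"
  shows "1 / 2 < upper_curve i j e t $ 2"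
proof -
  have "0 \<le> (t - 1/2)\<^sup>2" by simp
  then have "t * (1 - t) \<le> 1 / 4" by (simp add: power2_eq_square algebra_simps)
  moreover have "0 \<le> t * (1 - t)" using assms by simp
  ultimately have "(e * (of_int j - of_int i)\<^sup>2) * (t * (1 - t)) \<le> 1 * (1 / 4)"
    using assms by (intro mult_mono) auto
  moreover have "upper_curve i j e t $ 2 = 1 - (e * (of_int j - of_int i)\<^sup>2) * (t * (1 - t))"
    by (simp add: power2_eq_square algebra_simps)
  ultimately show ?thesis by linarith
qed

lemma upper_curve_simple:
  assumes "i < j" "0 < e" "e * (of_int j - of_int i)\<^sup>2 \<le> 1"
  shows "upper_curve i j e \<in> simple_curves {Upper i, Upper j}"
proof -
  have inj: "inj_on (upper_curve i j e) {0..1}"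
  proof (rule inj_onI)
    fix s t assume "upper_curve i j e s = upper_curve i j e t"
    then have "upper_curve i j e s $ 1 = upper_curve i j e t $ 1" by simp
    then show "s = t" using assms(1) by simp
  qed
  have pth: "path (upper_curve i j e)"
    unfolding path_def upper_curve_def[abs_def] by (intro continuous_on_vector2 continuous_intros)
  have rng: "upper_curve i j e t $ 2 \<le> 1 \<and> (upper_curve i j e t $ 2 = 1 \<longrightarrow> t = 0 \<or> t = 1)"
    if "0 \<le> t" "t \<le> 1" for t
    using that assms by auto
  have bd: "upper_curve i j e t \<in> boundary_lines \<longleftrightarrow> t = 0 \<or> t = 1" if "0 \<le> t" "t \<le> 1" for t
    using rng[OF that] upper_curve_depth[OF assms that] unfolding boundary_lines_def by auto
  have "path_image (upper_curve i j e) \<inter> boundary_lines = upper_curve i j e ` {0, 1}"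
    using bd unfolding path_image_def by (auto simp del: upper_curve_coords)
  moreover have "path_image (upper_curve i j e) \<subseteq> strip"
  proof -
    have "0 \<le> upper_curve i j e t $ 2 \<and> upper_curve i j e t $ 2 \<le> 1" if "0 \<le> t" "t \<le> 1" for t
      using rng[OF that] upper_curve_depth[OF assms that] by linarith
    then show ?thesis unfolding path_image_def strip_def by (auto simp del: upper_curve_coords)
  qed
  ultimately show ?thesis
    unfolding simple_curves_def arc_def pathstart_def pathfinish_def
    using inj pth by (auto simp: upper_curve_ends simp del: position.simps)
qed

lemma upper_curve_inner:
  assumes "i < j" "z \<in> path_image (upper_curve i j e)"
    "z \<notin> {pathstart (upper_curve i j e), pathfinish (upper_curve i j e)}"
  shows "of_int i < z $ 1" "z $ 1 < of_int j"
proof -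
  note im = upper_curve_image[OF assms(1,2)]
  have "z \<noteq> position (Upper i)" "z \<noteq> position (Upper j)"
    using assms(3) by (auto simp: pathstart_def pathfinish_def upper_curve_ends simp del: position.simps)
  then have "z $ 1 \<noteq> of_int i" "z $ 1 \<noteq> of_int j" using im(1) by (auto simp: vec_eq_iff forall_2)
  then show "of_int i < z $ 1" "z $ 1 < of_int j" using im(2,3) by simp_all
qed

lemma connecting_curve_inner:
  assumes "z \<in> path_image (connecting_curve i j c)"
    "z \<notin> {pathstart (connecting_curve i j c), pathfinish (connecting_curve i j c)}"
  shows "0 < z $ 2" "z $ 2 < 1"
    "z $ 1 = - of_int j + z $ 2 * (of_int i + of_int j) + c * (z $ 2 * (1 - z $ 2))"
proof -
  from assms(1) obtain t where t: "0 \<le> t" "t \<le> 1" "z = connecting_curve i j c t"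
    by (auto simp: path_image_def)
  with assms(2) have "t \<noteq> 0" "t \<noteq> 1" by (auto simp: pathstart_def pathfinish_def)
  with t show "0 < z $ 2" "z $ 2 < 1"
    "z $ 1 = - of_int j + z $ 2 * (of_int i + of_int j) + c * (z $ 2 * (1 - z $ 2))"
    by auto
qed

lemma not_arcs_crossI:
  "g \<in> simple_curves u \<Longrightarrow> h \<in> simple_curves v \<Longrightarrow> \<not> curves_cross g h \<Longrightarrow> \<not> arcs_cross u v"
  unfolding arcs_cross_def by blast

text \<open>At height \<open>t\<close> strictly between 0 and 1 the second curve lies to the right
  of the first by \<open>(1 - t) * (j - q) + t * (p - i) + t * (1 - t)\<close>. The last term comes
  from the bend and keeps the gap positive even for equal arcs.\<close>

lemma connecting_connecting_noncross:
  assumes "i \<le> p" "q \<le> j"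
  shows "\<not> arcs_cross {Upper i, Lower j} {Upper p, Lower q}"
proof (rule not_arcs_crossI[OF connecting_curve_simple[of i j 0] connecting_curve_simple[of p q 1]], rule notI)
  assume "curves_cross (connecting_curve i j 0) (connecting_curve p q 1)"
  then obtain z where z: "z \<in> path_image (connecting_curve i j 0)" "z \<in> path_image (connecting_curve p q 1)"
    "z \<notin> {pathstart (connecting_curve i j 0), pathfinish (connecting_curve i j 0)}"
    "z \<notin> {pathstart (connecting_curve p q 1), pathfinish (connecting_curve p q 1)}"
    unfolding curves_cross_def by blast
  note in1 = connecting_curve_inner[OF z(1,3)] and in2 = connecting_curve_inner[OF z(2,4)]
  have "0 < z $ 2 * (1 - z $ 2)" using in1 by simp
  moreover have "z $ 2 * of_int i \<le> z $ 2 * of_int p" "(1 - z $ 2) * of_int q \<le> (1 - z $ 2) * of_int j"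
    using assms in1 by (simp_all add: mult_left_mono)
  ultimately show False using in1(3) in2(3) by (simp add: algebra_simps)
qed

lemma small_height:
  fixes a b :: real
  assumes "0 \<le> a" "0 \<le> b"
  obtains e where "0 < e" "e * a < 1" "e * b < 1"
proof
  show "0 < 1 / (1 + a + b)" "1 / (1 + a + b) * a < 1" "1 / (1 + a + b) * b < 1"
    using assms by (auto simp: field_simps)
qed

text \<open>In the nested case the outer parabola gets twice the coefficient, so it is strictly
  deeper at every common abscissa, even if the arcs coincide. Otherwise the inner points have
  disjoint ranges of abscissas.\<close>

lemma upper_upper_noncross:
  assumes "i < j" "p < q" "j \<le> p \<or> i \<le> p \<and> q \<le> j"
  shows "\<not> arcs_cross {Upper i, Upper j} {Upper p, Upper q}"
proof -
  obtain e :: real where e: "0 < e" "e * (2 * (of_int j - of_int i)\<^sup>2) < 1" "e * (of_int q - of_int p)\<^sup>2 < 1"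
    using small_height[of "2 * (of_int j - of_int i)\<^sup>2" "(of_int q - of_int p)\<^sup>2"] by auto
  have s: "upper_curve i j (2 * e) \<in> simple_curves {Upper i, Upper j}"
    "upper_curve p q e \<in> simple_curves {Upper p, Upper q}"
    using e assms by (auto intro!: upper_curve_simple)
  show ?thesis
  proof (rule not_arcs_crossI[OF s], rule notI)
    assume "curves_cross (upper_curve i j (2 * e)) (upper_curve p q e)"
    then obtain z where z: "z \<in> path_image (upper_curve i j (2 * e))" "z \<in> path_image (upper_curve p q e)"
      "z \<notin> {pathstart (upper_curve i j (2 * e)), pathfinish (upper_curve i j (2 * e))}"
      "z \<notin> {pathstart (upper_curve p q e), pathfinish (upper_curve p q e)}"
      unfolding curves_cross_def by blast
    note in1 = upper_curve_inner[OF assms(1) z(1,3)] and in2 = upper_curve_inner[OF assms(2) z(2,4)]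
    have "\<not> j \<le> p" using in1 in2 by linarith
    then have le: "i \<le> p" "q \<le> j" using assms by auto
    have "2 * e * (z $ 1 - of_int i) * (of_int j - z $ 1) = e * (z $ 1 - of_int p) * (of_int q - z $ 1)"
      using upper_curve_image(1)[OF assms(1) z(1)] upper_curve_image(1)[OF assms(2) z(2)] by linarith
    then have "e * (2 * ((z $ 1 - of_int i) * (of_int j - z $ 1))) = e * ((z $ 1 - of_int p) * (of_int q - z $ 1))"
      by (simp only: mult_ac)
    then have "2 * ((z $ 1 - of_int i) * (of_int j - z $ 1)) = (z $ 1 - of_int p) * (of_int q - z $ 1)"
      using e(1) by (simp only: mult_cancel_left) simp
    also have "\<dots> \<le> (z $ 1 - of_int i) * (of_int j - z $ 1)"
      using in1 in2 le by (intro mult_mono) auto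
    finally show False using in1 by (simp add: mult_le_0_iff)
  qed
qed

text \<open>At depth \<open>t\<close> the straight curve from \<open>Upper r\<close> has moved
  sideways by only \<open>t * ?d\<close>. At a common point the abscissa is thus within
  \<open>t * ?d\<close> of an end of the parabola or beyond it, so the depth of the parabola is at
  most \<open>e * ?w * ?d * t\<close>, which is less than \<open>t\<close>.\<close>

lemma upper_connecting_noncross:
  assumes "i < j" "r \<le> i \<or> j \<le> r"
  shows "\<not> arcs_cross {Upper i, Upper j} {Upper r, Lower s}"
proof -
  let ?w = "of_int j - of_int i :: real" and ?d = "\<bar>of_int r + of_int s\<bar> :: real"
  obtain e :: real where e: "0 < e" "e * ?w\<^sup>2 < 1" "e * (?w * ?d) < 1"
    using small_height[of "?w\<^sup>2" "?w * ?d"] assms by auto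
  have s: "upper_curve i j e \<in> simple_curves {Upper i, Upper j}"
    using e assms by (auto intro!: upper_curve_simple)
  show ?thesis
  proof (rule not_arcs_crossI[OF s connecting_curve_simple[of r s 0]], rule notI)
    assume "curves_cross (upper_curve i j e) (connecting_curve r s 0)"
    then obtain z where z: "z \<in> path_image (upper_curve i j e)" "z \<in> path_image (connecting_curve r s 0)"
      "z \<notin> {pathstart (upper_curve i j e), pathfinish (upper_curve i j e)}"
      "z \<notin> {pathstart (connecting_curve r s 0), pathfinish (connecting_curve r s 0)}"
      unfolding curves_cross_def by blast
    note in1 = upper_curve_inner[OF assms(1) z(1,3)] and in2 = connecting_curve_inner[OF z(2,4)]
    define t where "t = 1 - z $ 2"
    have t: "0 < t" using in2 by (simp add: t_def)
    have x: "z $ 1 - of_int r = - (t * (of_int r + of_int s))"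
      using in2(3) by (simp add: t_def algebra_simps)
    have "\<bar>z $ 1 - of_int r\<bar> = t * ?d" unfolding x using t by (simp add: abs_mult)
    then have "z $ 1 - of_int i \<le> t * ?d \<or> of_int j - z $ 1 \<le> t * ?d" using assms(2) by auto
    then have "(z $ 1 - of_int i) * (of_int j - z $ 1) \<le> (t * ?d) * ?w"
    proof
      assume "z $ 1 - of_int i \<le> t * ?d"
      then show ?thesis using in1 t by (intro mult_mono) auto
    next
      assume "of_int j - z $ 1 \<le> t * ?d"
      then have "(of_int j - z $ 1) * (z $ 1 - of_int i) \<le> (t * ?d) * ?w"
        using in1 t by (intro mult_mono) auto
      then show ?thesis by (simp add: mult.commute)
    qed
    then have "e * ((z $ 1 - of_int i) * (of_int j - z $ 1)) \<le> e * ((t * ?d) * ?w)"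
      using e by simp
    moreover have "t = e * ((z $ 1 - of_int i) * (of_int j - z $ 1))"
      using upper_curve_image(1)[OF assms(1) z(1)] by (simp add: t_def mult.assoc)
    ultimately have "t \<le> t * (e * (?w * ?d))" by (simp add: mult_ac)
    moreover have "t * (e * (?w * ?d)) < t * 1" using t e(3) by (intro mult_strict_left_mono) auto
    ultimately show False by simp
  qed
qed

text \<open>The line at height 1/2 separates a flat parabola from a half-turned one.\<close>

lemma upper_lower_noncross:
  assumes "i < j" "p < q"
  shows "\<not> arcs_cross {Upper i, Upper j} {Lower p, Lower q}"
proof -
  obtain e :: real where e: "0 < e" "e * (of_int j - of_int i)\<^sup>2 < 1" "e * (of_int q - of_int p)\<^sup>2 < 1"
    using small_height[of "(of_int j - of_int i)\<^sup>2" "(of_int q - of_int p)\<^sup>2"] by auto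
  have s: "upper_curve i j e \<in> simple_curves {Upper i, Upper j}"
    using e assms by (auto intro!: upper_curve_simple)
  have "upper_curve p q e \<in> simple_curves {Upper p, Upper q}"
    using e assms by (auto intro!: upper_curve_simple)
  then have s': "half_turn \<circ> upper_curve p q e \<in> simple_curves {Lower p, Lower q}"
    using half_turn_simple_curves by fastforce
  have "z $ 2 > 1 / 2" if "z \<in> path_image (upper_curve i j e)" for z
    using that upper_curve_depth[of i j e] e assms by (auto simp: path_image_def simp del: upper_curve_coords)
  moreover have "z $ 2 < 1 / 2" if "z \<in> path_image (half_turn \<circ> upper_curve p q e)" for z
    using that upper_curve_depth[of p q e] e assms
    by (fastforce simp: path_image_def simp del: upper_curve_coords)
  ultimately show ?thesis
    by (intro not_arcs_crossI[OF s s']) (fastforce simp: curves_cross_def)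
qed

text \<open>From here on crossing is decided by comparing indices. Lower pairs are listed by
  increasing index, that is from right to left.\<close>

lemma arcs_cross_ordered:
  "i < j \<Longrightarrow> p < q \<Longrightarrow> arcs_cross {Upper i, Upper j} {Upper p, Upper q} \<longleftrightarrow>
     i < p \<and> p < j \<and> j < q \<or> p < i \<and> i < q \<and> q < j"
  "i < j \<Longrightarrow> arcs_cross {Upper i, Upper j} {Upper r, Lower s} \<longleftrightarrow> i < r \<and> r < j"
  "i < j \<Longrightarrow> p < q \<Longrightarrow> \<not> arcs_cross {Upper i, Upper j} {Lower p, Lower q}"
  "arcs_cross {Upper r, Lower s} {Upper r', Lower s'} \<longleftrightarrow> r < r' \<and> s < s' \<or> r' < r \<and> s' < s"
  "i < j \<Longrightarrow> p < q \<Longrightarrow> arcs_cross {Lower i, Lower j} {Lower p, Lower q} \<longleftrightarrow>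
     i < p \<and> p < j \<and> j < q \<or> p < i \<and> i < q \<and> q < j"
  "i < j \<Longrightarrow> arcs_cross {Lower i, Lower j} {Upper r, Lower s} \<longleftrightarrow> i < s \<and> s < j"
proof -
  show UU: "arcs_cross {Upper i, Upper j} {Upper p, Upper q} \<longleftrightarrow>
     i < p \<and> p < j \<and> j < q \<or> p < i \<and> i < q \<and> q < j" if "i < j" "p < q" for i j p q
  proof -
    have opp: "arcs_cross {Upper a, Upper b} {Upper c, Upper d} \<longleftrightarrow> arcs_cross {Lower a, Lower b} {Lower c, Lower d}"
      for a b c d
      using arcs_cross_opposite[of "{Lower a, Lower b}" "{Lower c, Lower d}"] by simp
    \<comment> \<open>The two interleavings, then the disjoint and nested positions in either order;
      shared ends and equal arcs fall under the last two cases.\<close>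
    consider "i < p \<and> p < j \<and> j < q" | "p < i \<and> i < q \<and> q < j"
      | "j \<le> p \<or> i \<le> p \<and> q \<le> j" | "q \<le> i \<or> p \<le> i \<and> j \<le> q"
      using \<open>i < j\<close> \<open>p < q\<close> by linarith
    then show ?thesis
    proof cases
      case 1 then show ?thesis using lower_lower_cross[of i p j q] opp by blast
    next
      case 2
      then have "arcs_cross {Upper p, Upper q} {Upper i, Upper j}"
        using lower_lower_cross[of p i q j] opp by blast
      with 2 show ?thesis using arcs_cross_commute by blast
    next
      case 3 then show ?thesis using upper_upper_noncross[OF that] that by auto
    next
      case 4
      then have "\<not> arcs_cross {Upper i, Upper j} {Upper p, Upper q}"
        using upper_upper_noncross[OF that(2,1)] arcs_cross_commute by blast
      with 4 that show ?thesis by auto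
    qed
  qed
  show UC: "arcs_cross {Upper i, Upper j} {Upper r, Lower s} \<longleftrightarrow> i < r \<and> r < j" if "i < j" for i j r s
  proof (cases "i < r \<and> r < j")
    case True
    then show ?thesis using lower_connecting_cross[of i r j s]
      arcs_cross_opposite[of "{Lower i, Lower j}" "{Upper s, Lower r}"] by (simp add: insert_commute)
  next
    case False
    then show ?thesis using that upper_connecting_noncross[of i j r s] by linarith
  qed
  show "i < j \<Longrightarrow> p < q \<Longrightarrow> \<not> arcs_cross {Upper i, Upper j} {Lower p, Lower q}"
    by (rule upper_lower_noncross)
  show "arcs_cross {Upper r, Lower s} {Upper r', Lower s'} \<longleftrightarrow> r < r' \<and> s < s' \<or> r' < r \<and> s' < s"
  proof -
    consider "r < r' \<and> s < s'" | "r' < r \<and> s' < s" | "r \<le> r' \<and> s' \<le> s" | "r' \<le> r \<and> s \<le> s'"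
      by linarith
    then show ?thesis
    proof cases
      case 1 then show ?thesis using connecting_connecting_cross by auto
    next
      case 2 then show ?thesis using connecting_connecting_cross arcs_cross_commute by blast
    next
      case 3 then show ?thesis using connecting_connecting_noncross by auto
    next
      case 4
      then have "\<not> arcs_cross {Upper r, Lower s} {Upper r', Lower s'}"
        using connecting_connecting_noncross arcs_cross_commute by blast
      with 4 show ?thesis by auto
    qed
  qed
  show "i < j \<Longrightarrow> p < q \<Longrightarrow> arcs_cross {Lower i, Lower j} {Lower p, Lower q} \<longleftrightarrow>
     i < p \<and> p < j \<and> j < q \<or> p < i \<and> i < q \<and> q < j"
    using UU[of i j p q] arcs_cross_opposite[of "{Lower i, Lower j}" "{Lower p, Lower q}"] by simp
  show "i < j \<Longrightarrow> arcs_cross {Lower i, Lower j} {Upper r, Lower s} \<longleftrightarrow> i < s \<and> s < j"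
    using UC[of i j s r] arcs_cross_opposite[of "{Lower i, Lower j}" "{Upper r, Lower s}"]
    by (simp add: insert_commute)
qed

subsection \<open>Symmetries of the strip\<close>

text \<open>The witnesses hidden in \<open>strip_arcs\<close> may name the ends in the other order.
  Being an edge depends only on the set, which the opaque predicate \<open>edge\<close>
  exploits.\<close>

lemma pair_in_strip_arcs:
  assumes "p \<noteq> q"
  shows "{p, q} \<in> strip_arcs \<longleftrightarrow>
    \<not> (\<exists>i. {p, q} = {Upper i, Upper (i + 1)} \<or> {p, q} = {Lower i, Lower (i + 1)})"
proof -
  define edge where
    "edge u \<longleftrightarrow> (\<exists>i. u = {Upper i, Upper (i + 1)} \<or> u = {Lower i, Lower (i + 1)})" for u
  have eq: "strip_arcs = {{p, q} | p q. p \<noteq> q \<and> \<not> edge {p, q}}"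
    unfolding strip_arcs_def edge_def ..
  have "\<forall>u \<in> strip_arcs. \<not> edge u" "\<not> edge {p, q} \<Longrightarrow> {p, q} \<in> strip_arcs"
    unfolding eq using assms by auto
  then have "{p, q} \<in> strip_arcs \<longleftrightarrow> \<not> edge {p, q}" by blast
  then show ?thesis unfolding edge_def .
qed

lemma upper_pair_in_strip_arcs [simp]: "i < j \<Longrightarrow> {Upper i, Upper j} \<in> strip_arcs \<longleftrightarrow> i + 1 < j"
  by (subst pair_in_strip_arcs) (auto simp: doubleton_eq_iff)

lemma lower_pair_in_strip_arcs [simp]: "i < j \<Longrightarrow> {Lower i, Lower j} \<in> strip_arcs \<longleftrightarrow> i + 1 < j"
  by (subst pair_in_strip_arcs) (auto simp: doubleton_eq_iff)

lemma connecting_pair_in_strip_arcs [simp]: "{Upper i, Lower j} \<in> strip_arcs"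
  by (subst pair_in_strip_arcs) (auto simp: doubleton_eq_iff)

lemma strip_arcs_cases:
  assumes "u \<in> strip_arcs"
  obtains (upper) i j where "i + 1 < j" "u = {Upper i, Upper j}"
    | (lower) i j where "i + 1 < j" "u = {Lower i, Lower j}"
    | (connecting) i j where "u = {Upper i, Lower j}"
proof -
  from assms obtain p q where u: "u = {p, q}" "p \<noteq> q" unfolding strip_arcs_def by blast
  have *: thesis if "u = {Upper i, Upper j}" "i < j" for i j
    using that assms upper by auto
  have **: thesis if "u = {Lower i, Lower j}" "i < j" for i j
    using that assms lower by auto
  show thesis
  proof (cases p)
    case p: (Upper i)
    show ?thesis
    proof (cases q)
      case (Upper j)
      then show ?thesis using *[of i j] *[of j i] u p by (cases "i < j") (auto simp: insert_commute)
    next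
      case (Lower j) then show ?thesis using u p connecting by blast
    qed
  next
    case p: (Lower i)
    show ?thesis
    proof (cases q)
      case (Lower j)
      then show ?thesis using **[of i j] **[of j i] u p by (cases "i < j") (auto simp: insert_commute)
    next
      case (Upper j) then show ?thesis using u p connecting by (metis insert_commute)
    qed
  qed
qed

lemma connecting_arc_iff: "connecting_arc u \<longleftrightarrow> (\<exists>i j. u = {Upper i, Lower j})"
proof
  assume "connecting_arc u"
  then have u: "u \<in> strip_arcs" "\<not> u \<subseteq> range Upper" "\<not> u \<subseteq> range Lower"
    unfolding connecting_arc_def upper_arc_def lower_arc_def by auto
  show "\<exists>i j. u = {Upper i, Lower j}" using u(1) by (cases rule: strip_arcs_cases) (use u in auto)
next
  assume "\<exists>i j. u = {Upper i, Lower j}"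
  then show "connecting_arc u"
    unfolding connecting_arc_def upper_arc_def lower_arc_def by auto
qed

lemma translation_pair [simp]:
  "translation {Upper i, Upper j} = {Upper (i + 1), Upper (j + 1)}"
  "translation {Lower i, Lower j} = {Lower (i + 1), Lower (j + 1)}"
  "translation {Upper i, Lower j} = {Upper (i + 1), Lower (j + 1)}"
  "inverse_translation {Upper i, Upper j} = {Upper (i - 1), Upper (j - 1)}"
  "inverse_translation {Lower i, Lower j} = {Lower (i - 1), Lower (j - 1)}"
  "inverse_translation {Upper i, Lower j} = {Upper (i - 1), Lower (j - 1)}"
  by (auto simp: translation_def inverse_translation_def)

lemma arcs_cross_flipped:
  "i < j \<Longrightarrow> arcs_cross {Upper r, Lower s} {Upper i, Upper j} \<longleftrightarrow> i < r \<and> r < j"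
  "i < j \<Longrightarrow> arcs_cross {Upper r, Lower s} {Lower i, Lower j} \<longleftrightarrow> i < s \<and> s < j"
  "i < j \<Longrightarrow> p < q \<Longrightarrow> \<not> arcs_cross {Lower p, Lower q} {Upper i, Upper j}"
  by (subst arcs_cross_commute, simp add: arcs_cross_ordered)+

lemmas arcs_cross_simps = arcs_cross_ordered arcs_cross_flipped

section \<open>Reflection in the vertical axis\<close>

fun mirror :: "marked_point \<Rightarrow> marked_point" where
  "mirror (Upper i) = Upper (- i)"
| "mirror (Lower i) = Lower (- i)"

lemma mirror_mirror [simp]: "mirror (mirror p) = p"
  by (cases p) auto

lemma mirror_pair:
  "mirror ` {Upper i, Upper j} = {Upper (- j), Upper (- i)}"
  "mirror ` {Lower i, Lower j} = {Lower (- j), Lower (- i)}"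
  "mirror ` {Upper i, Lower j} = {Upper (- i), Lower (- j)}"
  by auto

lemma opposite_pair:
  "opposite ` {Upper i, Upper j} = {Lower i, Lower j}"
  "opposite ` {Lower i, Lower j} = {Upper i, Upper j}"
  "opposite ` {Upper i, Lower j} = {Upper j, Lower i}"
  by auto

text \<open>This is a check on indices: negation reverses every inequality in the crossing rules,
  and the ends of upper and lower pairs change places.\<close>

lemma arcs_cross_mirror:
  assumes "u \<in> strip_arcs" "v \<in> strip_arcs"
  shows "arcs_cross (mirror ` u) (mirror ` v) \<longleftrightarrow> arcs_cross u v"
  using assms(1)
proof (cases rule: strip_arcs_cases)
  case (upper i j)
  note u = this
  show ?thesis using assms(2)
    by (cases rule: strip_arcs_cases) (use u in \<open>auto simp only: mirror_pair arcs_cross_simps\<close>)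
next
  case (lower i j)
  note u = this
  show ?thesis using assms(2)
    by (cases rule: strip_arcs_cases) (use u in \<open>auto simp only: mirror_pair arcs_cross_simps\<close>)
next
  case (connecting i j)
  note u = this
  show ?thesis using assms(2)
    by (cases rule: strip_arcs_cases) (use u in \<open>auto simp only: mirror_pair arcs_cross_simps\<close>)
qed

section \<open>Transport of triangulations along a symmetry\<close>

text \<open>
  The last alternative accounts for \<^const>\<open>mirror\<close>; compactness is symmetric in the two translations.
\<close>

definition strip_symmetry :: "(marked_point \<Rightarrow> marked_point) \<Rightarrow> bool" where
  "strip_symmetry f \<longleftrightarrow> (\<forall>p. f (f p) = p) \<and> (\<forall>u \<in> strip_arcs. f ` u \<in> strip_arcs) \<and>
    (\<forall>u \<in> strip_arcs. \<forall>v \<in> strip_arcs. arcs_cross (f ` u) (f ` v) \<longleftrightarrow> arcs_cross u v) \<and>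
    (\<forall>u. connecting_arc u \<longrightarrow> connecting_arc (f ` u)) \<and>
    ((\<forall>u. translation (f ` u) = f ` translation u \<and> inverse_translation (f ` u) = f ` inverse_translation u) \<or>
     (\<forall>u. translation (f ` u) = f ` inverse_translation u \<and> inverse_translation (f ` u) = f ` translation u))"

lemma strip_symmetry_opposite: "strip_symmetry opposite"
proof -
  have "opposite ` u \<in> strip_arcs" if "u \<in> strip_arcs" for u
    using that by (cases rule: strip_arcs_cases) (simp_all only: opposite_pair, simp_all)
  moreover have "connecting_arc (opposite ` u)" if "connecting_arc u" for u
    using that unfolding connecting_arc_iff by (metis opposite_pair(3))
  moreover have "shift_point k (opposite p) = opposite (shift_point k p)" for k p
    by (cases p) auto
  ultimately show ?thesis
    unfolding strip_symmetry_def translation_def inverse_translation_def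
    by (simp add: arcs_cross_opposite image_image)
qed

lemma strip_symmetry_mirror: "strip_symmetry mirror"
proof -
  have "mirror ` u \<in> strip_arcs" if "u \<in> strip_arcs" for u
    using that by (cases rule: strip_arcs_cases) (simp_all only: mirror_pair, simp_all)
  moreover have "connecting_arc (mirror ` u)" if "connecting_arc u" for u
    using that unfolding connecting_arc_iff by (metis mirror_pair(3))
  moreover have "shift_point k (mirror p) = mirror (shift_point (- k) p)" for k p
    by (cases p) auto
  ultimately show ?thesis
    unfolding strip_symmetry_def translation_def inverse_translation_def
    by (simp add: arcs_cross_mirror image_image)
qed

lemma strip_symmetryD:
  assumes "strip_symmetry f"
  shows "f (f p) = p" "f ` f ` u = u" "(`) f ` (`) f ` T = T"
    "v \<in> (`) f ` T \<longleftrightarrow> f ` v \<in> T"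
    "u \<in> strip_arcs \<Longrightarrow> f ` u \<in> strip_arcs"
    "u \<in> strip_arcs \<Longrightarrow> w \<in> strip_arcs \<Longrightarrow> arcs_cross (f ` u) (f ` w) \<longleftrightarrow> arcs_cross u w"
    "connecting_arc (f ` u) \<longleftrightarrow> connecting_arc u"
proof -
  show inv: "f (f p) = p" for p using assms by (simp add: strip_symmetry_def)
  show inv2: "f ` f ` u = u" for u by (simp add: image_image inv)
  show "(`) f ` (`) f ` T = T" using inv2 by (auto simp: image_iff)
  show "v \<in> (`) f ` T \<longleftrightarrow> f ` v \<in> T" using inv2 by (auto simp: image_iff) (metis inv2)
  show "u \<in> strip_arcs \<Longrightarrow> f ` u \<in> strip_arcs"
    "u \<in> strip_arcs \<Longrightarrow> w \<in> strip_arcs \<Longrightarrow> arcs_cross (f ` u) (f ` w) \<longleftrightarrow> arcs_cross u w"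
    using assms by (simp_all add: strip_symmetry_def)
  show "connecting_arc (f ` u) \<longleftrightarrow> connecting_arc u"
    using assms inv2 unfolding strip_symmetry_def by metis
qed

lemma strip_symmetry_noncrossing:
  assumes f: "strip_symmetry f" and T: "noncrossing_arcs T"
  shows "noncrossing_arcs ((`) f ` T)"
  unfolding noncrossing_arcs_def
proof (intro conjI pairwiseI)
  show "(`) f ` T \<subseteq> strip_arcs"
    using T strip_symmetryD(5)[OF f] unfolding noncrossing_arcs_def by auto
  fix u v assume "u \<in> (`) f ` T" "v \<in> (`) f ` T" "u \<noteq> v"
  then obtain u' v' where "u = f ` u'" "v = f ` v'" "u' \<in> T" "v' \<in> T" "u' \<noteq> v'" by blast
  then show "\<not> arcs_cross u v"
    using T strip_symmetryD(6)[OF f] unfolding noncrossing_arcs_def pairwise_def by (metis subsetD)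
qed

lemma strip_symmetry_triangulation:
  assumes f: "strip_symmetry f" and T: "strip_triangulation T"
  shows "strip_triangulation ((`) f ` T)"
  unfolding strip_triangulation_def
proof (intro conjI allI impI)
  show "noncrossing_arcs ((`) f ` T)"
    using strip_symmetry_noncrossing[OF f] T by (simp add: strip_triangulation_def)
  fix T' assume T': "noncrossing_arcs T' \<and> (`) f ` T \<subseteq> T'"
  \<comment> \<open>Maximality is pulled back: the image of \<open>T'\<close> extends
    \<open>T\<close> and hence equals it.\<close>
  then have "noncrossing_arcs ((`) f ` T')" "(`) f ` (`) f ` T \<subseteq> (`) f ` T'"
    using strip_symmetry_noncrossing[OF f] by blast+
  then have "(`) f ` T' = T"
    using T unfolding strip_triangulation_def strip_symmetryD(3)[OF f] by blast
  then show "T' = (`) f ` T" using strip_symmetryD(3)[OF f] by metis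
qed

lemma strip_symmetry_arcs_crossing:
  assumes f: "strip_symmetry f" and "T \<subseteq> strip_arcs" "u \<in> strip_arcs"
  shows "arcs_crossing ((`) f ` T) (f ` u) = (`) f ` arcs_crossing T u"
  using assms strip_symmetryD(6)[OF f] unfolding arcs_crossing_def by blast

section \<open>Covering by finitely many translates\<close>

definition covered :: "marked_point set set \<Rightarrow> marked_point set set \<Rightarrow> bool" where
  "covered D E \<longleftrightarrow> (\<exists>S \<subseteq> D. finite S \<and>
     (\<forall>u \<in> E. (\<exists>v \<in> S. arcs_cross u (translation v)) \<and> (\<exists>v \<in> S. arcs_cross u (inverse_translation v))))"

text \<open>Splitting the two roles of \<open>D\<close> allows the covered set to be cut into
  finitely many pieces while the covering arcs still come from all of \<open>D\<close>.\<close>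

lemma compact_arcs_iff_covered: "compact_arcs D \<longleftrightarrow> covered D D"
  unfolding compact_arcs_def covered_def by simp

lemma covered_mono: "covered D E \<Longrightarrow> E' \<subseteq> E \<Longrightarrow> covered D E'"
  unfolding covered_def by blast

lemma covered_Un:
  assumes "covered D E" "covered D E'"
  shows "covered D (E \<union> E')"
proof -
  obtain S S' where "S \<subseteq> D" "finite S" "S' \<subseteq> D" "finite S'"
    "\<forall>u \<in> E. (\<exists>v \<in> S. arcs_cross u (translation v)) \<and> (\<exists>v \<in> S. arcs_cross u (inverse_translation v))"
    "\<forall>u \<in> E'. (\<exists>v \<in> S'. arcs_cross u (translation v)) \<and> (\<exists>v \<in> S'. arcs_cross u (inverse_translation v))"
    using assms unfolding covered_def by metis
  then show ?thesis unfolding covered_def by (intro exI[of _ "S \<union> S'"]) blast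
qed

lemma covered_UN: "finite I \<Longrightarrow> (\<And>i. i \<in> I \<Longrightarrow> covered D (E i)) \<Longrightarrow> covered D (\<Union>i\<in>I. E i)"
proof (induction rule: finite_induct)
  case empty
  show ?case unfolding covered_def by auto
next
  case (insert i I)
  then show ?case by (simp add: covered_Un)
qed

text \<open>For upper and lower arcs \<open>i + 1 < j\<close> makes the shifted ends interleave with
  the old ones; for a connecting arc both indices change in the same direction. Hence a finite set
  of arcs covers itself.\<close>

lemma arcs_cross_translation:
  assumes "u \<in> strip_arcs"
  shows "arcs_cross u (translation u)" "arcs_cross u (inverse_translation u)"
  using assms by (cases rule: strip_arcs_cases; simp add: arcs_cross_simps)+

lemma covered_finite:
  assumes "E \<subseteq> D" "D \<subseteq> strip_arcs" "finite E"
  shows "covered D E"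
  unfolding covered_def using assms arcs_cross_translation by (intro exI[of _ E]) blast

lemma translation_in_strip_arcs:
  assumes "u \<in> strip_arcs"
  shows "translation u \<in> strip_arcs" "inverse_translation u \<in> strip_arcs"
  using assms by (cases rule: strip_arcs_cases; simp)+

lemma strip_symmetry_covered:
  assumes f: "strip_symmetry f" and arcs: "D \<subseteq> strip_arcs" "E \<subseteq> strip_arcs" and cov: "covered D E"
  shows "covered ((`) f ` D) ((`) f ` E)"
proof -
  obtain S where S: "S \<subseteq> D" "finite S"
    "\<forall>u \<in> E. (\<exists>v \<in> S. arcs_cross u (translation v)) \<and> (\<exists>v \<in> S. arcs_cross u (inverse_translation v))"
    using cov unfolding covered_def by blast
  have "(\<exists>v \<in> S. arcs_cross (f ` u) (translation (f ` v))) \<and> (\<exists>v \<in> S. arcs_cross (f ` u) (inverse_translation (f ` v)))"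
    if u: "u \<in> E" for u
  proof -
    obtain v w where vw: "v \<in> S" "w \<in> S" "arcs_cross u (translation v)" "arcs_cross u (inverse_translation w)"
      using S(3) u by blast
    have "u \<in> strip_arcs" "translation v \<in> strip_arcs" "inverse_translation w \<in> strip_arcs"
      using translation_in_strip_arcs vw(1,2) S(1) arcs u by auto
    with vw have "arcs_cross (f ` u) (f ` translation v)" "arcs_cross (f ` u) (f ` inverse_translation w)"
      using strip_symmetryD(6)[OF f] by simp_all
    \<comment> \<open>A reflection turns the translation into its inverse, so \<open>v\<close> and
      \<open>w\<close> may exchange roles.\<close>
    moreover have "f ` translation v = translation (f ` v) \<and> f ` inverse_translation w = inverse_translation (f ` w) \<or>
      f ` translation v = inverse_translation (f ` v) \<and> f ` inverse_translation w = translation (f ` w)"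
      using f unfolding strip_symmetry_def by auto
    ultimately show ?thesis using vw(1,2) by auto
  qed
  then show ?thesis unfolding covered_def using S(1,2) by (intro exI[of _ "(`) f ` S"]) auto
qed

lemma strip_symmetry_compact_triangulation:
  assumes f: "strip_symmetry f" and T: "compact_triangulation T"
  shows "compact_triangulation ((`) f ` T)"
proof -
  have tri: "strip_triangulation T" using T by (simp add: compact_triangulation_def)
  then have arcs: "T \<subseteq> strip_arcs" by (simp add: strip_triangulation_def noncrossing_arcs_def)
  have "covered (arcs_crossing ((`) f ` T) u) (arcs_crossing ((`) f ` T) u)" if u: "u \<in> strip_arcs" for u
  proof -
    have u': "f ` u \<in> strip_arcs" using strip_symmetryD(5)[OF f u] .
    have "covered (arcs_crossing T (f ` u)) (arcs_crossing T (f ` u))"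
      using T u' by (simp add: compact_triangulation_def compact_arcs_iff_covered)
    moreover have "arcs_crossing T (f ` u) \<subseteq> strip_arcs" using arcs by (auto simp: arcs_crossing_def)
    ultimately have "covered ((`) f ` arcs_crossing T (f ` u)) ((`) f ` arcs_crossing T (f ` u))"
      using strip_symmetry_covered[OF f] by blast
    then show ?thesis
      using strip_symmetry_arcs_crossing[OF f arcs u'] by (simp add: strip_symmetryD(2)[OF f])
  qed
  then show ?thesis
    using strip_symmetry_triangulation[OF f tri]
    by (simp add: compact_triangulation_def compact_arcs_iff_covered)
qed

definition admissible :: "marked_point set set \<Rightarrow> bool" where
  "admissible T \<longleftrightarrow> (\<forall>p. bounded_point T p \<or> infinite {u \<in> T. connecting_arc u \<and> p \<in> u})"

lemma strip_symmetry_admissible: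
  assumes f: "strip_symmetry f" and T: "admissible T"
  shows "admissible ((`) f ` T)"
  unfolding admissible_def bounded_point_def
proof
  fix p
  have mem: "p \<in> f ` u \<longleftrightarrow> f p \<in> u" for u
    using strip_symmetryD(1)[OF f] by (auto simp: image_iff) metis
  have inj: "inj ((`) f)" by (rule injI) (metis strip_symmetryD(2)[OF f])
  have "{u \<in> (`) f ` T. p \<in> u} = (`) f ` {u \<in> T. f p \<in> u}"
    "{u \<in> (`) f ` T. connecting_arc u \<and> p \<in> u} = (`) f ` {u \<in> T. connecting_arc u \<and> f p \<in> u}"
    using mem strip_symmetryD(7)[OF f] by auto
  moreover have "finite ((`) f ` A) \<longleftrightarrow> finite A" for A
    by (rule finite_image_iff) (rule inj_on_subset[OF inj subset_UNIV])
  ultimately show "finite {u \<in> (`) f ` T. p \<in> u} \<or> infinite {u \<in> (`) f ` T. connecting_arc u \<and> p \<in> u}"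
    using T unfolding admissible_def bounded_point_def by simp
qed

subsection \<open>Triangulations\<close>

lemma triangulation_noncrossing:
  assumes "strip_triangulation T"
  shows "u \<in> T \<Longrightarrow> v \<in> T \<Longrightarrow> u \<noteq> v \<Longrightarrow> \<not> arcs_cross u v" "T \<subseteq> strip_arcs"
  using assms unfolding strip_triangulation_def noncrossing_arcs_def pairwise_def by blast+

lemma triangulation_maximal:
  assumes T: "strip_triangulation T" and u: "u \<in> strip_arcs" "u \<notin> T"
  obtains v where "v \<in> T" "arcs_cross v u"
proof (rule ccontr)
  assume "\<not> thesis"
  then have "\<not> arcs_cross v u" "\<not> arcs_cross u v" if "v \<in> T" for v
    using that \<open>\<And>v. v \<in> T \<Longrightarrow> arcs_cross v u \<Longrightarrow> thesis\<close> arcs_cross_commute by blast+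
  moreover have "noncrossing_arcs T" using T by (simp add: strip_triangulation_def)
  ultimately have "noncrossing_arcs (insert u T)"
    using u(1) unfolding noncrossing_arcs_def pairwise_insert by auto
  then have "insert u T = T" using T unfolding strip_triangulation_def by blast
  then show False using u(2) by blast
qed

lemma triangulation_pairs:
  assumes T: "strip_triangulation T"
  shows upper_upper_False: "{Upper i, Upper j} \<in> T \<Longrightarrow> {Upper p, Upper q} \<in> T \<Longrightarrow> i < p \<Longrightarrow> p < j \<Longrightarrow> j < q \<Longrightarrow> False"
    and lower_lower_False: "{Lower i, Lower j} \<in> T \<Longrightarrow> {Lower p, Lower q} \<in> T \<Longrightarrow> i < p \<Longrightarrow> p < j \<Longrightarrow> j < q \<Longrightarrow> False"
    and upper_connecting_False: "{Upper i, Upper j} \<in> T \<Longrightarrow> {Upper r, Lower s} \<in> T \<Longrightarrow> i < r \<Longrightarrow> r < j \<Longrightarrow> False"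
    and lower_connecting_False: "{Lower i, Lower j} \<in> T \<Longrightarrow> {Upper r, Lower s} \<in> T \<Longrightarrow> i < s \<Longrightarrow> s < j \<Longrightarrow> False"
    and connecting_connecting_False: "{Upper i, Lower j} \<in> T \<Longrightarrow> {Upper r, Lower s} \<in> T \<Longrightarrow> i < r \<Longrightarrow> j < s \<Longrightarrow> False"
  using triangulation_noncrossing(1)[OF T, of "{Upper i, Upper j}" "{Upper p, Upper q}"]
    triangulation_noncrossing(1)[OF T, of "{Lower i, Lower j}" "{Lower p, Lower q}"]
    triangulation_noncrossing(1)[OF T, of "{Upper i, Upper j}" "{Upper r, Lower s}"]
    triangulation_noncrossing(1)[OF T, of "{Lower i, Lower j}" "{Upper r, Lower s}"]
    triangulation_noncrossing(1)[OF T, of "{Upper i, Lower j}" "{Upper r, Lower s}"]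
  by (simp_all add: arcs_cross_simps doubleton_eq_iff)

text \<open>By maximality a missing arc is blocked by an arc of \<open>T\<close>. Listing the
  blockers by shape lets later proofs exclude them one by one.\<close>

lemma triangulation_upper_cases:
  assumes T: "strip_triangulation T" and "i + 1 < j" "{Upper i, Upper j} \<notin> T"
  obtains (left) a c where "{Upper a, Upper c} \<in> T" "a < i" "i < c" "c < j"
    | (right) a c where "{Upper a, Upper c} \<in> T" "i < a" "a < j" "j < c"
    | (connecting) r s where "{Upper r, Lower s} \<in> T" "i < r" "r < j"
proof -
  obtain v where v: "v \<in> T" "arcs_cross v {Upper i, Upper j}"
    using triangulation_maximal[OF T _ assms(3)] assms(2) by auto
  have "v \<in> strip_arcs" using v(1) triangulation_noncrossing(2)[OF T] by blast
  then show thesis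
  proof (cases rule: strip_arcs_cases)
    case (upper a c)
    then have "a < i \<and> i < c \<and> c < j \<or> i < a \<and> a < j \<and> j < c"
      using v(2) assms(2) by (auto simp: arcs_cross_simps)
    then show thesis using v(1) upper left right by blast
  next
    case (lower a c) then show thesis using v(2) assms(2) by (simp add: arcs_cross_simps)
  next
    case (connecting r s) then show thesis
      using v that(3)[of r s] assms(2) by (simp add: arcs_cross_simps)
  qed
qed

lemma triangulation_connecting_cases:
  assumes T: "strip_triangulation T" and "{Upper i, Lower j} \<notin> T"
  obtains (upper) a c where "{Upper a, Upper c} \<in> T" "a < i" "i < c"
    | (lower) a c where "{Lower a, Lower c} \<in> T" "a < j" "j < c"
    | (connecting) r s where "{Upper r, Lower s} \<in> T" "r < i \<and> s < j \<or> i < r \<and> j < s"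
proof -
  obtain v where v: "v \<in> T" "arcs_cross v {Upper i, Lower j}"
    using triangulation_maximal[OF T _ assms(2)] by auto
  have "v \<in> strip_arcs" using v(1) triangulation_noncrossing(2)[OF T] by blast
  then show thesis
  proof (cases rule: strip_arcs_cases)
    case (upper a c) then show thesis using v that(1)[of a c] by (simp add: arcs_cross_simps)
  next
    case (lower a c) then show thesis using v that(2)[of a c] by (simp add: arcs_cross_simps)
  next
    case (connecting r s) then show thesis using v that(3)[of r s] by (auto simp: arcs_cross_simps)
  qed
qed

lemma infinite_connecting_iff:
  "infinite {u \<in> T. connecting_arc u \<and> Upper k \<in> u} \<longleftrightarrow> infinite {q. {Upper k, Lower q} \<in> T}"
  "infinite {u \<in> T. connecting_arc u \<and> Lower k \<in> u} \<longleftrightarrow> infinite {p. {Upper p, Lower k} \<in> T}"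
proof -
  have "{u \<in> T. connecting_arc u \<and> Upper k \<in> u} = (\<lambda>q. {Upper k, Lower q}) ` {q. {Upper k, Lower q} \<in> T}"
    unfolding connecting_arc_iff by auto
  then show "infinite {u \<in> T. connecting_arc u \<and> Upper k \<in> u} \<longleftrightarrow> infinite {q. {Upper k, Lower q} \<in> T}"
    by (simp add: finite_image_iff inj_on_def doubleton_eq_iff)
  have "{u \<in> T. connecting_arc u \<and> Lower k \<in> u} = (\<lambda>p. {Upper p, Lower k}) ` {p. {Upper p, Lower k} \<in> T}"
    unfolding connecting_arc_iff by auto
  then show "infinite {u \<in> T. connecting_arc u \<and> Lower k \<in> u} \<longleftrightarrow> infinite {p. {Upper p, Lower k} \<in> T}"
    by (simp add: finite_image_iff inj_on_def doubleton_eq_iff)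
qed

lemma bounded_point_finite:
  assumes "bounded_point T p" "inj f"
  shows "finite {b. {p, f b} \<in> T}"
proof -
  have "inj_on (\<lambda>b. {p, f b}) {b. {p, f b} \<in> T}"
    using assms(2) by (auto simp: inj_on_def doubleton_eq_iff)
  moreover have "(\<lambda>b. {p, f b}) ` {b. {p, f b} \<in> T} \<subseteq> {u \<in> T. p \<in> u}" by auto
  ultimately show ?thesis
    using assms(1) unfolding bounded_point_def by (meson finite_imageD finite_subset)
qed

text \<open>Infinitely many arcs to the same boundary line make the point unbounded, so the other
  alternative of \<open>admissible\<close> must hold.\<close>

lemma admissible_infinite_connecting:
  assumes "admissible T"
  shows "infinite {b. {Upper k, Upper b} \<in> T} \<Longrightarrow> infinite {q. {Upper k, Lower q} \<in> T}"
    "infinite {b. {Lower k, Lower b} \<in> T} \<Longrightarrow> infinite {p. {Upper p, Lower k} \<in> T}"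
proof -
  have "inj Upper" "inj Lower" by (auto intro: injI)
  then show "infinite {b. {Upper k, Upper b} \<in> T} \<Longrightarrow> infinite {q. {Upper k, Lower q} \<in> T}"
    "infinite {b. {Lower k, Lower b} \<in> T} \<Longrightarrow> infinite {p. {Upper p, Lower k} \<in> T}"
    using assms bounded_point_finite unfolding admissible_def infinite_connecting_iff[symmetric]
    by blast+
qed

section \<open>Upper and connecting arcs of a right fan\<close>

lemma infinite_int_unbounded:
  fixes S :: "int set"
  assumes "infinite S"
  shows "\<not> (\<forall>x \<in> S. a \<le> x \<and> x \<le> b)"
proof
  assume "\<forall>x \<in> S. a \<le> x \<and> x \<le> b"
  then have "S \<subseteq> {a..b}" by auto
  then show False using assms finite_subset by blast
qed

text \<open>Lower points with small index lie far to the right, so the connecting arcs at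
  \<open>Upper k\<close> forbid connecting arcs that start right of \<open>k\<close>. If
  \<open>m\<close> were the farthest right neighbour of \<open>k\<close>, and \<open>c\<close> that
  of \<open>m\<close>, the arc from \<open>k\<close> to \<open>c\<close> would be missing although
  nothing in \<open>T\<close> blocks it.\<close>

lemma right_connecting_imp_right_upper:
  assumes T: "strip_triangulation T" and adm: "admissible T"
    and fan: "\<And>N. \<exists>q < N. {Upper k, Lower q} \<in> T"
  shows "\<exists>b > N. {Upper k, Upper b} \<in> T"
proof (rule ccontr)
  assume neg: "\<not> (\<exists>b > N. {Upper k, Upper b} \<in> T)"
  have no_conn: False if "{Upper i, Lower j} \<in> T" "k < i" for i j
    using fan[of j] connecting_connecting_False[OF T] that by blast
  \<comment> \<open>The default \<open>k + 1\<close> lets the boundary edge serve as a side of the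
    triangle when no arc leaves \<open>Upper k\<close> to the right; \<open>m + 1\<close> does the
    same below.\<close>
  define M where "M = insert (k + 1) {b. k < b \<and> {Upper k, Upper b} \<in> T}"
  have "{b. k < b \<and> {Upper k, Upper b} \<in> T} \<subseteq> {k..N}" using neg by force
  then have finM: "finite M" unfolding M_def using finite_subset by blast
  define m where "m = Max M"
  have "m \<in> M" unfolding m_def using finM by (intro Max_in) (auto simp: M_def)
  then have m: "k < m" "m = k + 1 \<or> {Upper k, Upper m} \<in> T" by (auto simp: M_def)
  have m_max: "b \<le> m" if "k < b" "{Upper k, Upper b} \<in> T" for b
    unfolding m_def using finM that by (intro Max_ge) (auto simp: M_def)
  \<comment> \<open>As \<open>Upper m\<close> carries no connecting arc, admissibility leaves only
    finitely many upper arcs there, so a farthest neighbour \<open>c\<close> exists.\<close>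
  have "{q. {Upper m, Lower q} \<in> T} = {}" using no_conn m(1) by blast
  then have "finite {b. {Upper m, Upper b} \<in> T}"
    using admissible_infinite_connecting(1)[OF adm, of m] by auto
  define K where "K = insert (m + 1) {c. m < c \<and> {Upper m, Upper c} \<in> T}"
  have finK: "finite K" unfolding K_def using \<open>finite {b. {Upper m, Upper b} \<in> T}\<close> by simp
  define c where "c = Max K"
  have "c \<in> K" unfolding c_def using finK by (intro Max_in) (auto simp: K_def)
  then have c: "m < c" "c = m + 1 \<or> {Upper m, Upper c} \<in> T" by (auto simp: K_def)
  have c_max: "b \<le> c" if "m < b" "{Upper m, Upper b} \<in> T" for b
    unfolding c_def using finK that by (intro Max_ge) (auto simp: K_def)
  have new: "k + 1 < c" "{Upper k, Upper c} \<notin> T" using m_max[of c] m c by auto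
  from T new show False
  proof (cases rule: triangulation_upper_cases)
    case (left a d)
    then show ?thesis using upper_connecting_False[OF T left(1)] fan by blast
  next
    case (right a d)
    consider "a < m" | "a = m" | "m < a" by linarith
    then show ?thesis
    proof cases
      case 1
      then have e: "{Upper k, Upper m} \<in> T" using m(2) right by auto
      then show ?thesis using upper_upper_False[OF T e right(1)] 1 right c by auto
    next
      case 2 then show ?thesis using c_max[of d] right c by auto
    next
      case 3
      then have e: "{Upper m, Upper c} \<in> T" using c(2) right by auto
      then show ?thesis using upper_upper_False[OF T e right(1)] 3 right by auto
    qed
  next
    case (connecting r s) then show ?thesis using no_conn by blast
  qed
qed

text \<open>Let \<open>Lower q0\<close> be the rightmost lower point joined to
  \<open>Upper k\<close>. If it had finitely many lower arcs, a triangle as in the previous lemma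
  would yield a connecting arc from \<open>Upper k\<close> further right. If it has infinitely many,
  admissibility produces two connecting arcs that cross.\<close>

lemma right_upper_imp_right_connecting:
  assumes T: "strip_triangulation T" and adm: "admissible T"
    and fan: "\<And>N. \<exists>b > N. {Upper k, Upper b} \<in> T"
  shows "\<exists>q < N. {Upper k, Lower q} \<in> T"
proof (rule ccontr)
  assume neg: "\<not> (\<exists>q < N. {Upper k, Lower q} \<in> T)"
  have no_conn: False if "{Upper i, Lower j} \<in> T" "k < i" for i j
    using fan[of i] upper_connecting_False[OF T] that by blast
  have "infinite {b. {Upper k, Upper b} \<in> T}"
  proof
    assume fin: "finite {b. {Upper k, Upper b} \<in> T}"
    obtain b where b: "Max {b. {Upper k, Upper b} \<in> T} < b" "{Upper k, Upper b} \<in> T"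
      using fan by blast
    have "b \<le> Max {b. {Upper k, Upper b} \<in> T}" using fin b(2) by (intro Max_ge) simp_all
    with b(1) show False by simp
  qed
  then have infQ: "infinite {q. {Upper k, Lower q} \<in> T}"
    by (rule admissible_infinite_connecting(1)[OF adm])
  then obtain q1 where q1: "{Upper k, Lower q1} \<in> T" using infinite_imp_nonempty by blast
  \<comment> \<open>Cutting off above the known element \<open>q1\<close> makes the set finite
    without changing the minimum.\<close>
  define Q where "Q = {q. q \<le> q1 \<and> {Upper k, Lower q} \<in> T}"
  have "Q \<subseteq> {N..q1}" unfolding Q_def using neg by force
  then have finQ: "finite Q" using finite_subset by blast
  define q0 where "q0 = Min Q"
  have "q0 \<in> Q" unfolding q0_def using finQ \<open>{Upper k, Lower q1} \<in> T\<close> by (intro Min_in) (auto simp: Q_def)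
  then have q0: "{Upper k, Lower q0} \<in> T" "q0 \<le> q1" by (auto simp: Q_def)
  have q0_min: "q0 \<le> q" if "{Upper k, Lower q} \<in> T" for q
  proof (cases "q \<le> q1")
    case True then show ?thesis unfolding q0_def using finQ that by (intro Min_le) (auto simp: Q_def)
  next
    case False then show ?thesis using q0 by simp
  qed
  have "infinite {b. {Lower q0, Lower b} \<in> T}"
  proof
    assume "finite {b. {Lower q0, Lower b} \<in> T}"
    \<comment> \<open>The minimum is the farthest lower neighbour to the right of
      \<open>Lower q0\<close>; \<open>q0 - 1\<close> stands for the boundary edge.\<close>
    then have finM: "finite (insert (q0 - 1) {b. {Lower q0, Lower b} \<in> T \<and> b < q0})" (is "finite ?M") by simp
    define m where "m = Min ?M"
    have "m \<in> ?M" unfolding m_def using finM by (intro Min_in) auto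
    then have m: "m < q0" "m = q0 - 1 \<or> {Lower q0, Lower m} \<in> T" by auto
    have m_min: "m \<le> b" if "{Lower q0, Lower b} \<in> T" "b < q0" for b
      unfolding m_def using finM that by (intro Min_le) auto
    have "{Upper k, Lower m} \<notin> T" using q0_min m(1) by force
    with T show False
    proof (cases rule: triangulation_connecting_cases)
      case (upper a c)
      then show ?thesis using fan[of c] upper_upper_False[OF T upper(1)] by blast
    next
      case (lower a c)
      consider "c < q0" | "c = q0" | "q0 < c" by linarith
      then show ?thesis
      proof cases
        case 1
        then have e: "{Lower m, Lower q0} \<in> T" using m(2) lower by (auto simp: insert_commute)
        then show ?thesis using lower_lower_False[OF T lower(1) e] lower 1 by auto
      next
        case 2 then show ?thesis using m_min[of a] lower m(1) by (auto simp: insert_commute)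
      next
        case 3 then show ?thesis using lower_connecting_False[OF T lower(1) q0(1)] lower m(1) by auto
      qed
    next
      case (connecting r s)
      then show ?thesis using no_conn[of r s] connecting_connecting_False[OF T connecting(1) q0(1)] m(1) by auto
    qed
  qed
  then have infP: "infinite {p. {Upper p, Lower q0} \<in> T}"
    by (rule admissible_infinite_connecting(2)[OF adm])
  \<comment> \<open>A further upper neighbour \<open>p\<close> of \<open>Lower q0\<close> is left of
    \<open>k\<close>, and a further lower neighbour \<open>q\<close> of \<open>Upper k\<close> has
    \<open>q0 < q\<close>; these two connecting arcs cross.\<close>
  obtain p where p: "{Upper p, Lower q0} \<in> T" "p \<noteq> k"
    using infinite_int_unbounded[OF infP, of k k] by auto
  then have "p < k" using no_conn[of p q0] by force
  obtain q where "{Upper k, Lower q} \<in> T" "q \<noteq> q0"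
    using infinite_int_unbounded[OF infQ, of q0 q0] by auto
  then show False using connecting_connecting_False[OF T p(1)] \<open>p < k\<close> q0_min[of q] by force
qed

text \<open>The cut at \<open>0\<close> is arbitrary but fixed by \<open>mirror\<close>, so the
  right fan at \<open>k\<close> and the mirror image of the right fan at \<open>- k\<close> together
  contain every arc that ends at \<open>Upper k\<close>.\<close>

definition right_fan :: "int \<Rightarrow> marked_point set set" where
  "right_fan k = {v. \<exists>b > k. v = {Upper k, Upper b}} \<union> {v. \<exists>q \<le> 0. v = {Upper k, Lower q}}"

lemma right_fanI:
  "k < b \<Longrightarrow> {Upper k, Upper b} \<in> right_fan k" "q \<le> 0 \<Longrightarrow> {Upper k, Lower q} \<in> right_fan k"
  unfolding right_fan_def by blast+

text \<open>\<open>R\<close> tells whether \<open>u\<close> separates \<open>Upper k\<close> from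
  the right end of the strip, towards which both kinds of arcs run.\<close>

lemma right_fan_eventually_crosses:
  assumes "u \<in> strip_arcs"
  obtains N R where "\<And>b. N < b \<Longrightarrow> arcs_cross {Upper k, Upper b} u \<longleftrightarrow> R"
    "\<And>q. q < - N \<Longrightarrow> arcs_cross {Upper k, Lower q} u \<longleftrightarrow> R"
  using assms
proof (cases rule: strip_arcs_cases)
  case (upper x y)
  show thesis
    by (rule that[of "\<bar>k\<bar> + \<bar>y\<bar>" "x < k \<and> k < y"]) (use upper in \<open>auto simp: arcs_cross_simps\<close>)
next
  case (lower x y)
  show thesis
    by (rule that[of "\<bar>k\<bar> + \<bar>x\<bar>" False]) (use lower in \<open>auto simp: arcs_cross_simps\<close>)
next
  case (connecting r s)
  show thesis
    by (rule that[of "\<bar>k\<bar> + \<bar>r\<bar> + \<bar>s\<bar>" "k < r"]) (use connecting in \<open>auto simp: arcs_cross_simps\<close>)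
qed

text \<open>By \<open>k + 1 < b\<close> the point \<open>k\<close> lies strictly between the ends
  \<open>k - 1\<close> and \<open>b - 1\<close> of the inverse translate, and \<open>k + 1\<close>
  strictly inside every upper arc of the tail.\<close>

lemma right_fan_tail_covered:
  assumes "{Upper k, Upper b} \<in> D" "{Upper k, Lower q} \<in> D" "k + 1 < b"
  shows "covered D ({v. \<exists>b' \<ge> b. v = {Upper k, Upper b'}} \<union> {v. \<exists>q' \<le> q. v = {Upper k, Lower q'}})"
  unfolding covered_def
proof (intro exI conjI ballI)
  show "{{Upper k, Upper b}, {Upper k, Lower q}} \<subseteq> D" "finite {{Upper k, Upper b}, {Upper k, Lower q}}"
    using assms by auto
  fix v assume "v \<in> {v. \<exists>b' \<ge> b. v = {Upper k, Upper b'}} \<union> {v. \<exists>q' \<le> q. v = {Upper k, Lower q'}}"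
  then consider b' where "b \<le> b'" "v = {Upper k, Upper b'}" | q' where "q' \<le> q" "v = {Upper k, Lower q'}"
    by blast
  then have "arcs_cross v (translation {Upper k, Lower q}) \<and> arcs_cross v (inverse_translation {Upper k, Upper b})"
    by cases (use assms(3) in \<open>simp_all add: arcs_cross_simps\<close>)
  then show "\<exists>w \<in> {{Upper k, Upper b}, {Upper k, Lower q}}. arcs_cross v (translation w)"
    "\<exists>w \<in> {{Upper k, Upper b}, {Upper k, Lower q}}. arcs_cross v (inverse_translation w)"
    by blast+
qed

lemma right_fan_covered:
  assumes T: "strip_triangulation T" and adm: "admissible T" and u: "u \<in> strip_arcs"
  shows "covered (arcs_crossing T u) (arcs_crossing T u \<inter> right_fan k)"
proof -
  let ?D = "arcs_crossing T u"
  have arcs: "?D \<subseteq> strip_arcs" using triangulation_noncrossing(2)[OF T] by (auto simp: arcs_crossing_def)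
  \<comment> \<open>The part of the fan within given bounds is finite, so it is covered by its own
    translates.\<close>
  define F where "F b q = ?D \<inter> ((\<lambda>b'. {Upper k, Upper b'}) ` {k..b} \<union> (\<lambda>q'. {Upper k, Lower q'}) ` {q..0})" for b q
  have covF: "covered ?D (F b q)" for b q
    by (rule covered_finite[OF _ arcs]) (auto simp: F_def)
  obtain N R where NR: "\<And>b. N < b \<Longrightarrow> arcs_cross {Upper k, Upper b} u \<longleftrightarrow> R"
    "\<And>q. q < - N \<Longrightarrow> arcs_cross {Upper k, Lower q} u \<longleftrightarrow> R"
    by (rule right_fan_eventually_crosses[OF u]) blast
  show ?thesis
  proof (cases "R \<and> (\<forall>N. \<exists>b > N. {Upper k, Upper b} \<in> T)")
    case True
    \<comment> \<open>The maximum secures \<open>k + 1 < b\<close> for the tail along with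
      \<open>N < b\<close>.\<close>
    then have "\<exists>b > max N (k + 1). {Upper k, Upper b} \<in> T" by blast
    then obtain b where b: "N < b" "k + 1 < b" "{Upper k, Upper b} \<in> T" by auto
    obtain q where q: "q < - N" "{Upper k, Lower q} \<in> T"
      using right_upper_imp_right_connecting[OF T adm] True by blast
    have "{Upper k, Upper b} \<in> ?D" "{Upper k, Lower q} \<in> ?D"
      using NR b q True by (auto simp: arcs_crossing_def)
    then have "covered ?D ({v. \<exists>b' \<ge> b. v = {Upper k, Upper b'}} \<union> {v. \<exists>q' \<le> q. v = {Upper k, Lower q'}})"
      using right_fan_tail_covered b(2) by blast
    moreover have "?D \<inter> right_fan k \<subseteq> ({v. \<exists>b' \<ge> b. v = {Upper k, Upper b'}} \<union> {v. \<exists>q' \<le> q. v = {Upper k, Lower q'}}) \<union> F b q"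
    proof
      fix v assume v: "v \<in> ?D \<inter> right_fan k"
      then consider b' where "k < b'" "v = {Upper k, Upper b'}" | q' where "q' \<le> 0" "v = {Upper k, Lower q'}"
        unfolding right_fan_def by blast
      then show "v \<in> ({v. \<exists>b' \<ge> b. v = {Upper k, Upper b'}} \<union> {v. \<exists>q' \<le> q. v = {Upper k, Lower q'}}) \<union> F b q"
      proof cases
        case 1 then show ?thesis using v by (cases "b \<le> b'") (auto simp: F_def)
      next
        case 2 then show ?thesis using v by (cases "q' \<le> q") (auto simp: F_def)
      qed
    qed
    ultimately show ?thesis using covF covered_Un covered_mono by meson
  next
    case False
    have "\<exists>b q. ?D \<inter> right_fan k \<subseteq> F b q"
    proof (cases R)
      case True
      then obtain B where B: "\<And>b. B < b \<Longrightarrow> {Upper k, Upper b} \<notin> T" using False by blast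
      \<comment> \<open>Contrapositive of \<open>right_connecting_imp_right_upper\<close>: a bound
        on the upper arcs also bounds the connecting ones.\<close>
      then obtain M where M: "\<And>q. q < M \<Longrightarrow> {Upper k, Lower q} \<notin> T"
        using right_connecting_imp_right_upper[OF T adm] by blast
      have "?D \<inter> right_fan k \<subseteq> F B M"
      proof
        fix v assume v: "v \<in> ?D \<inter> right_fan k"
        then have "v \<in> T" by (simp add: arcs_crossing_def)
        from v consider b' where "k < b'" "v = {Upper k, Upper b'}" | q' where "q' \<le> 0" "v = {Upper k, Lower q'}"
          unfolding right_fan_def by blast
        then show "v \<in> F B M"
        proof cases
          case 1 then have "\<not> B < b'" using B \<open>v \<in> T\<close> by blast
          then show ?thesis using 1 v by (auto simp: F_def)
        next
          case 2 then have "\<not> q' < M" using M \<open>v \<in> T\<close> by blast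
          then show ?thesis using 2 v by (auto simp: F_def)
        qed
      qed
      then show ?thesis by blast
    next
      case False
      have "?D \<inter> right_fan k \<subseteq> F N (- N)"
      proof
        fix v assume v: "v \<in> ?D \<inter> right_fan k"
        then have cr: "arcs_cross v u" by (simp add: arcs_crossing_def)
        from v consider b' where "k < b'" "v = {Upper k, Upper b'}" | q' where "q' \<le> 0" "v = {Upper k, Lower q'}"
          unfolding right_fan_def by blast
        then show "v \<in> F N (- N)"
        proof cases
          case 1 then have "\<not> N < b'" using NR(1) cr False by blast
          then show ?thesis using 1 v by (auto simp: F_def)
        next
          case 2 then have "\<not> q' < - N" using NR(2) cr False by blast
          then show ?thesis using 2 v by (auto simp: F_def)
        qed
      qed
      then show ?thesis by blast
    qed
    then show ?thesis using covF covered_mono by blast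
  qed
qed

section \<open>From fans to stars and to compactness\<close>

lemma strip_symmetry_covered_crossing:
  assumes f: "strip_symmetry f" and T: "T \<subseteq> strip_arcs" and u: "u \<in> strip_arcs"
    and cov: "covered (arcs_crossing ((`) f ` T) (f ` u)) (arcs_crossing ((`) f ` T) (f ` u) \<inter> X)"
  shows "covered (arcs_crossing T u) (arcs_crossing T u \<inter> (`) f ` X)"
proof -
  let ?D = "arcs_crossing T u"
  have arcs: "(`) f ` ?D \<subseteq> strip_arcs"
    using T strip_symmetryD(5)[OF f] by (auto simp: arcs_crossing_def)
  have "covered ((`) f ` ?D) ((`) f ` ?D \<inter> X)"
    using cov unfolding strip_symmetry_arcs_crossing[OF f T u] .
  \<comment> \<open>Applying the involution once more leads back from the transformed triangulation
    to \<open>T\<close>.\<close>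
  then have "covered ((`) f ` (`) f ` ?D) ((`) f ` ((`) f ` ?D \<inter> X))"
    using arcs by (intro strip_symmetry_covered[OF f]) auto
  moreover have "inj ((`) f)" by (rule injI) (metis strip_symmetryD(2)[OF f])
  ultimately show ?thesis by (simp only: image_Int strip_symmetryD(3)[OF f])
qed

lemma upper_star_covered:
  assumes T: "strip_triangulation T" and adm: "admissible T" and u: "u \<in> strip_arcs"
  shows "covered (arcs_crossing T u) (arcs_crossing T u \<inter> {v. Upper k \<in> v})"
proof -
  let ?D = "arcs_crossing T u" and ?T' = "(`) mirror ` T"
  note sym = strip_symmetry_mirror
  have arcs: "T \<subseteq> strip_arcs" using triangulation_noncrossing(2)[OF T] .
  have "covered ?D (?D \<inter> (`) mirror ` right_fan (- k))"
    by (intro strip_symmetry_covered_crossing[OF sym arcs u] right_fan_covered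
        strip_symmetry_triangulation[OF sym T] strip_symmetry_admissible[OF sym adm] strip_symmetryD(5)[OF sym u])
  moreover have "?D \<inter> {v. Upper k \<in> v} \<subseteq> (?D \<inter> right_fan k) \<union> (?D \<inter> (`) mirror ` right_fan (- k))"
  proof
    fix v assume v: "v \<in> ?D \<inter> {v. Upper k \<in> v}"
    then have "v \<in> strip_arcs" using arcs by (auto simp: arcs_crossing_def)
    have left: "{Upper a, Upper k} \<in> (`) mirror ` right_fan (- k)" if "a < k" for a
    proof -
      have "{Upper (- k), Upper (- a)} \<in> right_fan (- k)" using that by (intro right_fanI) simp
      then show ?thesis using mirror_pair(1)[of "- k" "- a"] by (metis image_eqI minus_minus)
    qed
    have left': "{Upper k, Lower q} \<in> (`) mirror ` right_fan (- k)" if "0 \<le> q" for q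
    proof -
      have "{Upper (- k), Lower (- q)} \<in> right_fan (- k)" using that by (intro right_fanI) simp
      then show ?thesis using mirror_pair(3)[of "- k" "- q"] by (metis image_eqI minus_minus)
    qed
    from \<open>v \<in> strip_arcs\<close> have "v \<in> right_fan k \<union> (`) mirror ` right_fan (- k)"
    proof (cases rule: strip_arcs_cases)
      case (upper i j)
      then have "k = i \<or> k = j" "i < j" using v by auto
      then show ?thesis using upper left[of i] right_fanI(1)[of k j] by blast
    next
      case (lower i j) then show ?thesis using v by auto
    next
      case (connecting i j)
      then have "i = k" using v by auto
      then show ?thesis using connecting left'[of j] right_fanI(2)[of j k]
        by (cases "0 \<le> j") auto
    qed
    then show "v \<in> (?D \<inter> right_fan k) \<union> (?D \<inter> (`) mirror ` right_fan (- k))" using v by blast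
  qed
  ultimately show ?thesis using right_fan_covered[OF T adm u] covered_Un covered_mono by meson
qed

lemma star_covered:
  assumes T: "strip_triangulation T" and adm: "admissible T" and u: "u \<in> strip_arcs"
  shows "covered (arcs_crossing T u) (arcs_crossing T u \<inter> {v. p \<in> v})"
proof (cases p)
  case (Upper k) then show ?thesis using upper_star_covered[OF assms] by simp
next
  case (Lower k)
  note sym = strip_symmetry_opposite
  have arcs: "T \<subseteq> strip_arcs" using triangulation_noncrossing(2)[OF T] .
  have "covered (arcs_crossing T u) (arcs_crossing T u \<inter> (`) opposite ` {v. Upper k \<in> v})"
    by (intro strip_symmetry_covered_crossing[OF sym arcs u] upper_star_covered
        strip_symmetry_triangulation[OF sym T] strip_symmetry_admissible[OF sym adm] strip_symmetryD(5)[OF sym u])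
  moreover have "(`) opposite ` {v. Upper k \<in> v} = {v. Lower k \<in> v}"
    using strip_symmetryD(4)[OF sym] by (force simp: image_iff)
  ultimately show ?thesis using Lower by simp
qed

text \<open>An arc crossing an upper or lower \<open>u\<close> has an end between the ends of
  \<open>u\<close>. For a connecting \<open>u\<close>, an arc of \<open>T\<close> crosses
  \<open>u\<close> but not the given connecting arc, so on one boundary line it has an end between
  those of the two.\<close>

lemma crossing_arcs_finite_stars:
  assumes T: "strip_triangulation T" and km: "{Upper k, Lower m} \<in> T" and u: "u \<in> strip_arcs"
  obtains P where "finite P" "\<And>v. v \<in> arcs_crossing T u \<Longrightarrow> \<exists>p \<in> P. p \<in> v"
  using u
proof (cases rule: strip_arcs_cases)
  case (upper x y)
  have "\<exists>p \<in> Upper ` {x..y}. p \<in> v" if "v \<in> arcs_crossing T u" for v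
  proof -
    have v: "v \<in> strip_arcs" "arcs_cross v u"
      using that triangulation_noncrossing(2)[OF T] by (auto simp: arcs_crossing_def)
    from v(1) show ?thesis by (cases rule: strip_arcs_cases) (use v(2) upper in \<open>auto simp: arcs_cross_simps\<close>)
  qed
  then show thesis using that[of "Upper ` {x..y}"] by blast
next
  case (lower x y)
  have "\<exists>p \<in> Lower ` {x..y}. p \<in> v" if "v \<in> arcs_crossing T u" for v
  proof -
    have v: "v \<in> strip_arcs" "arcs_cross v u"
      using that triangulation_noncrossing(2)[OF T] by (auto simp: arcs_crossing_def)
    from v(1) show ?thesis by (cases rule: strip_arcs_cases) (use v(2) lower in \<open>auto simp: arcs_cross_simps\<close>)
  qed
  then show thesis using that[of "Lower ` {x..y}"] by blast
next
  case (connecting r s)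
  let ?P = "Upper ` {min k r..max k r} \<union> Lower ` {min m s..max m s}"
  have "\<exists>p \<in> ?P. p \<in> v" if "v \<in> arcs_crossing T u" for v
  proof -
    have v: "v \<in> strip_arcs" "arcs_cross v u" "v \<in> T"
      using that triangulation_noncrossing(2)[OF T] by (auto simp: arcs_crossing_def)
    from v(1) show ?thesis
    proof (cases rule: strip_arcs_cases)
      case (upper a c)
      then have "a < r" "r < c" using v(2) connecting by (simp_all add: arcs_cross_simps)
      moreover have "\<not> (a < k \<and> k < c)" using upper_connecting_False[OF T _ km] upper v(3) by blast
      ultimately have "min k r \<le> a \<and> a \<le> max k r \<or> min k r \<le> c \<and> c \<le> max k r" by linarith
      then show ?thesis using upper by auto
    next
      case (lower a c)
      then have "a < s" "s < c" using v(2) connecting by (simp_all add: arcs_cross_simps)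
      moreover have "\<not> (a < m \<and> m < c)" using lower_connecting_False[OF T _ km] lower v(3) by blast
      ultimately have "min m s \<le> a \<and> a \<le> max m s \<or> min m s \<le> c \<and> c \<le> max m s" by linarith
      then show ?thesis using lower by auto
    next
      case c: (connecting i j)
      then have "i < r \<and> j < s \<or> r < i \<and> s < j" using v(2) connecting by (simp add: arcs_cross_simps)
      moreover have "\<not> (i < k \<and> j < m)" "\<not> (k < i \<and> m < j)"
        using connecting_connecting_False[OF T _ km] connecting_connecting_False[OF T km] c v(3) by blast+
      ultimately have "min k r \<le> i \<and> i \<le> max k r \<or> min m s \<le> j \<and> j \<le> max m s" by linarith
      then show ?thesis using c by auto
    qed
  qed
  then show thesis using that[of ?P] by blast
qed

lemma compact_if_admissible:
  assumes T: "strip_triangulation T" and adm: "admissible T" and "v \<in> T" "connecting_arc v"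
  shows "compact_triangulation T"
proof -
  obtain k m where km: "{Upper k, Lower m} \<in> T" using assms unfolding connecting_arc_iff by blast
  have "covered (arcs_crossing T u) (arcs_crossing T u)" if u: "u \<in> strip_arcs" for u
  proof -
    obtain P where P: "finite P" "\<And>v. v \<in> arcs_crossing T u \<Longrightarrow> \<exists>p \<in> P. p \<in> v"
      using crossing_arcs_finite_stars[OF T km u] by blast
    have "covered (arcs_crossing T u) (\<Union>p\<in>P. arcs_crossing T u \<inter> {v. p \<in> v})"
      by (intro covered_UN P(1) star_covered[OF T adm u])
    then show ?thesis by (rule covered_mono) (use P(2) in blast)
  qed
  then show ?thesis using T by (simp add: compact_triangulation_def compact_arcs_iff_covered)
qed

section \<open>Consequences of compactness\<close>

lemma compact_crossing:
  assumes T: "compact_triangulation T" and u: "u \<in> strip_arcs"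
  obtains S where "S \<subseteq> arcs_crossing T u" "finite S"
    "\<And>v. v \<in> arcs_crossing T u \<Longrightarrow> \<exists>w \<in> S. arcs_cross v (translation w)"
    "\<And>v. v \<in> arcs_crossing T u \<Longrightarrow> \<exists>w \<in> S. arcs_cross v (inverse_translation w)"
proof -
  have "covered (arcs_crossing T u) (arcs_crossing T u)"
    using T u by (simp add: compact_triangulation_def compact_arcs_iff_covered)
  then show thesis using that unfolding covered_def by blast
qed

lemma finite_upper_pairs:
  assumes "finite S"
  shows "finite {a. \<exists>c. {Upper a, Upper c} \<in> S}"
proof -
  \<comment> \<open>Members of \<open>S\<close> may be infinite sets; pairs are finite, so the
    restriction loses none of them.\<close>
  have "finite (\<Union> (S \<inter> {u. finite u}))" using assms by auto
  then have "finite (Upper -` \<Union> (S \<inter> {u. finite u}))" by (rule finite_vimageI) (auto intro: injI)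
  moreover have "{a. \<exists>c. {Upper a, Upper c} \<in> S} \<subseteq> Upper -` \<Union> (S \<inter> {u. finite u})"
  proof
    fix a assume "a \<in> {a. \<exists>c. {Upper a, Upper c} \<in> S}"
    then obtain c where "{Upper a, Upper c} \<in> S" by blast
    then show "a \<in> Upper -` \<Union> (S \<inter> {u. finite u})"
      by (intro vimageI2 UnionI[of "{Upper a, Upper c}"]) auto
  qed
  ultimately show ?thesis using finite_subset by blast
qed

text \<open>The upper arcs over \<open>0\<close> are those crossing
  \<open>{Upper 0, Lower 0}\<close>, and compactness bounds their left ends from below. The least
  left end is uncovered: an arc over it would cross the arc starting there or would itself pass over
  \<open>0\<close> with a smaller left end.\<close>

lemma compact_upper_uncovered:
  assumes comp: "compact_triangulation T" and no_conn: "\<And>v. v \<in> T \<Longrightarrow> \<not> connecting_arc v"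
  obtains r where "\<And>a c. {Upper a, Upper c} \<in> T \<Longrightarrow> \<not> (a < r \<and> r < c)"
proof (cases "\<exists>a c. {Upper a, Upper c} \<in> T \<and> a < 0 \<and> 0 < c")
  case False
  then show thesis using that[of 0] by blast
next
  case True
  have T: "strip_triangulation T" using comp by (simp add: compact_triangulation_def)
  let ?u = "{Upper 0, Lower 0}"
  obtain S where S: "S \<subseteq> arcs_crossing T ?u" "finite S"
    "\<And>v. v \<in> arcs_crossing T ?u \<Longrightarrow> \<exists>w \<in> S. arcs_cross v (inverse_translation w)"
    by (rule compact_crossing[OF comp, of ?u]) auto
  have left_end: "\<exists>a' \<in> {a. \<exists>c. {Upper a, Upper c} \<in> S}. a' \<le> a"
    if ac: "{Upper a, Upper c} \<in> T" "a < 0" "0 < c" for a c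
  proof -
    have "{Upper a, Upper c} \<in> arcs_crossing T ?u" using ac by (simp add: arcs_crossing_def arcs_cross_simps)
    then obtain w where w: "w \<in> S" "arcs_cross {Upper a, Upper c} (inverse_translation w)" using S(3) by blast
    then have "w \<in> T" "arcs_cross w ?u" using S(1) by (auto simp: arcs_crossing_def)
    have "w \<in> strip_arcs" using \<open>w \<in> T\<close> triangulation_noncrossing(2)[OF T] by blast
    then show ?thesis
    proof (cases rule: strip_arcs_cases)
      case (upper a' c')
      then have "a' < 0" "0 < c'" using \<open>arcs_cross w ?u\<close> by (simp_all add: arcs_cross_simps)
      \<comment> \<open>The first alternative would make \<open>w\<close> itself cross the given
        arc; the second gives \<open>a' - 1 < a\<close>, which for integers is the wanted
        bound.\<close>
      moreover have "a < a' - 1 \<and> a' - 1 < c \<and> c < c' - 1 \<or> a' - 1 < a \<and> a < c' - 1 \<and> c' - 1 < c"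
        using w(2) upper ac by (simp add: arcs_cross_simps)
      moreover have "\<not> (a < a' \<and> a' < c \<and> c < c')"
        using upper_upper_False[OF T ac(1)] upper \<open>w \<in> T\<close> by blast
      ultimately have "a' \<le> a" using ac by linarith
      then show ?thesis using upper w(1) by blast
    next
      case (lower a' c')
      then show ?thesis using \<open>w \<in> T\<close> w(2) ac by (simp add: arcs_cross_simps)
    next
      case (connecting i j)
      then show ?thesis using no_conn[OF \<open>w \<in> T\<close>] unfolding connecting_arc_iff by blast
    qed
  qed
  define A where "A = {a. a < 0 \<and> (\<exists>c > 0. {Upper a, Upper c} \<in> T)}"
  define L where "L = Min {a. \<exists>c. {Upper a, Upper c} \<in> S}"
  have "L \<le> a" if a: "a \<in> A" for a
  proof -
    obtain c where "{Upper a, Upper c} \<in> T" "a < 0" "0 < c" using a unfolding A_def by blast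
    from left_end[OF this] obtain a' where "a' \<in> {a. \<exists>c. {Upper a, Upper c} \<in> S}" "a' \<le> a" ..
    then show ?thesis unfolding L_def using finite_upper_pairs[OF S(2)] Min_le order_trans by blast
  qed
  moreover have "a < 0" if "a \<in> A" for a using that by (simp add: A_def)
  ultimately have "A \<subseteq> {L..0}" by (meson atLeastAtMost_iff less_imp_le subsetI)
  then have finA: "finite A" using finite_subset by blast
  have "A \<noteq> {}" using True unfolding A_def by blast
  then have "Min A \<in> A" using finA by simp
  then obtain c0 where c0: "Min A < 0" "0 < c0" "{Upper (Min A), Upper c0} \<in> T" unfolding A_def by blast
  show thesis
  proof (rule that[of "Min A"], rule notI)
    fix a c assume ac: "{Upper a, Upper c} \<in> T" "a < Min A \<and> Min A < c"
    then have "\<not> c < c0" using upper_upper_False[OF T ac(1) c0(3)] by blast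
    then have "a < 0" "0 < c" using ac c0 by linarith+
    then have "a \<in> A" using ac(1) unfolding A_def by blast
    then show False using Min_le[OF finA, of a] ac(2) by simp
  qed
qed

text \<open>An uncovered point on each boundary line, the lower one found by the half turn, yields
  an arc that only connecting arcs could block.\<close>

lemma compact_connecting_arc:
  assumes comp: "compact_triangulation T"
  shows "\<exists>v \<in> T. connecting_arc v"
proof (rule ccontr)
  assume neg: "\<not> (\<exists>v \<in> T. connecting_arc v)"
  note sym = strip_symmetry_opposite
  have T: "strip_triangulation T" using comp by (simp add: compact_triangulation_def)
  obtain r where r: "\<And>a c. {Upper a, Upper c} \<in> T \<Longrightarrow> \<not> (a < r \<and> r < c)"
    using compact_upper_uncovered[OF comp] neg by blast
  have "\<not> connecting_arc v" if "v \<in> (`) opposite ` T" for v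
    using neg that strip_symmetryD(7)[OF sym] by auto
  then obtain s where s: "\<And>a c. {Upper a, Upper c} \<in> (`) opposite ` T \<Longrightarrow> \<not> (a < s \<and> s < c)"
    using compact_upper_uncovered[OF strip_symmetry_compact_triangulation[OF sym comp]] by blast
  have s': "\<not> (a < s \<and> s < c)" if "{Lower a, Lower c} \<in> T" for a c
    using s[of a c] that unfolding strip_symmetryD(4)[OF sym] opposite_pair by blast
  have "connecting_arc {Upper r, Lower s}" by (auto simp: connecting_arc_iff)
  then have "{Upper r, Lower s} \<notin> T" using neg by blast
  with T show False
  proof (cases rule: triangulation_connecting_cases)
    case (upper a c) then show ?thesis using r by blast
  next
    case (lower a c) then show ?thesis using s' by blast
  next
    case (connecting i j) then show ?thesis using neg unfolding connecting_arc_iff by blast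
  qed
qed

text \<open>Far arcs from \<open>k\<close> must cross the translate of some \<open>w\<close> in a
  finite set. An upper \<open>w\<close> starting at \<open>k\<close> is too short for this, and one
  starting further left would already cross such an arc within \<open>T\<close>; a connecting
  \<open>w\<close> is excluded by the choice of \<open>s\<close> or by crossing within
  \<open>T\<close>.\<close>

lemma compact_right_upper:
  assumes comp: "compact_triangulation T" and inf: "infinite {b. k < b \<and> {Upper k, Upper b} \<in> T}"
  shows "infinite {q. {Upper k, Lower q} \<in> T}"
proof
  assume fin: "finite {q. {Upper k, Lower q} \<in> T}"
  have T: "strip_triangulation T" using comp by (simp add: compact_triangulation_def)
  \<comment> \<open>Only a lower bound matters; \<open>0\<close> makes the set nonempty.\<close>
  define s where "s = Min (insert 0 {q. {Upper k, Lower q} \<in> T})"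
  have s: "s \<le> q" if "{Upper k, Lower q} \<in> T" for q
    unfolding s_def using fin that by (intro Min_le) auto
  let ?u = "{Upper (k + 1), Lower s}"
  obtain S where S: "S \<subseteq> arcs_crossing T ?u" "finite S"
    "\<And>v. v \<in> arcs_crossing T ?u \<Longrightarrow> \<exists>w \<in> S. arcs_cross v (translation w)"
    by (rule compact_crossing[OF comp, of ?u]) auto
  \<comment> \<open>Choosing \<open>b\<close> beyond \<open>B\<close> puts it past both ends of
    every upper arc in \<open>S\<close>, and the inserted element ensures
    \<open>k + 1 < b\<close>.\<close>
  define B where "B = insert (k + 1) {b. \<exists>a. {Upper b, Upper a} \<in> S}"
  have finB: "finite B" unfolding B_def using finite_upper_pairs[OF S(2)] by simp
  obtain b where b: "k < b" "{Upper k, Upper b} \<in> T" "\<not> (k \<le> b \<and> b \<le> Max B)"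
    using infinite_int_unbounded[OF inf] by blast
  have B_less: "c < b" if "c \<in> B" for c using Max_ge[OF finB that] b(1,3) by linarith
  have "k + 1 < b" using B_less by (simp add: B_def)
  then have "{Upper k, Upper b} \<in> arcs_crossing T ?u" using b by (simp add: arcs_crossing_def arcs_cross_simps)
  then obtain w where w: "w \<in> S" "arcs_cross {Upper k, Upper b} (translation w)" using S(3) by blast
  then have "w \<in> T" "arcs_cross w ?u" using S(1) by (auto simp: arcs_crossing_def)
  have "w \<in> strip_arcs" using \<open>w \<in> T\<close> triangulation_noncrossing(2)[OF T] by blast
  then show False
  proof (cases rule: strip_arcs_cases)
    case (upper a c)
    then have "a < k + 1" "k + 1 < c" using \<open>arcs_cross w ?u\<close> by (simp_all add: arcs_cross_simps)
    moreover have "k < a + 1 \<and> a + 1 < b \<and> b < c + 1 \<or> a + 1 < k \<and> k < c + 1 \<and> c + 1 < b"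
      using w(2) upper b(1) by (simp add: arcs_cross_simps)
    moreover have "c < b" using B_less[of c] w(1) upper by (auto simp: B_def insert_commute)
    moreover have "\<not> (a < k \<and> k < c \<and> c < b)"
      using upper_upper_False[OF T _ b(2)] upper \<open>w \<in> T\<close> by blast
    ultimately show ?thesis by linarith
  next
    case (lower a c)
    then show ?thesis using w(2) b(1) by (simp add: arcs_cross_simps)
  next
    case (connecting i j)
    then have "k < i + 1" "i + 1 < b" using w(2) b(1) by (simp_all add: arcs_cross_simps)
    moreover have "i < k + 1 \<and> j < s \<or> k + 1 < i \<and> s < j"
      using \<open>arcs_cross w ?u\<close> connecting by (simp add: arcs_cross_simps)
    moreover have "\<not> (k < i \<and> i < b)" using upper_connecting_False[OF T b(2)] connecting \<open>w \<in> T\<close> by blast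
    moreover have "i = k \<Longrightarrow> s \<le> j" using s connecting \<open>w \<in> T\<close> by blast
    ultimately show ?thesis by linarith
  qed
qed

text \<open>Finitely many connecting arcs would allow only finitely many upper arcs to the right
  and, by reflection, to the left, making the whole star finite.\<close>

lemma compact_unbounded_upper:
  assumes comp: "compact_triangulation T" and unb: "\<not> bounded_point T (Upper k)"
  shows "infinite {q. {Upper k, Lower q} \<in> T}"
proof
  assume fin: "finite {q. {Upper k, Lower q} \<in> T}"
  note sym = strip_symmetry_mirror
  have arcs: "T \<subseteq> strip_arcs"
    using comp triangulation_noncrossing(2) by (simp add: compact_triangulation_def)
  have right: "finite {b. k < b \<and> {Upper k, Upper b} \<in> T}" using compact_right_upper[OF comp] fin by blast
  have mem: "{Upper (- k), Upper (- b)} \<in> (`) mirror ` T \<longleftrightarrow> {Upper k, Upper b} \<in> T"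
    "{Upper (- k), Lower (- b)} \<in> (`) mirror ` T \<longleftrightarrow> {Upper k, Lower b} \<in> T" for b
    unfolding strip_symmetryD(4)[OF sym] mirror_pair by (simp_all add: insert_commute)
  have inj: "inj (uminus :: int \<Rightarrow> int)" by (rule injI) simp
  have "{q. {Upper (- k), Lower q} \<in> (`) mirror ` T} = uminus -` {q. {Upper k, Lower q} \<in> T}"
    using mem(2)[of "- q" for q] by (simp add: vimage_def)
  then have "finite {q. {Upper (- k), Lower q} \<in> (`) mirror ` T}"
    using finite_vimageI[OF fin inj] by simp
  then have "finite {b. - k < b \<and> {Upper (- k), Upper b} \<in> (`) mirror ` T}"
    using compact_right_upper[OF strip_symmetry_compact_triangulation[OF sym comp]] by blast
  moreover have "{b. b < k \<and> {Upper k, Upper b} \<in> T} =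
    uminus -` {b. - k < b \<and> {Upper (- k), Upper b} \<in> (`) mirror ` T}"
    unfolding vimage_def by (simp add: mem(1))
  ultimately have left: "finite {b. b < k \<and> {Upper k, Upper b} \<in> T}"
    by (simp only: finite_vimageI[OF _ inj])
  have "{u \<in> T. Upper k \<in> u} \<subseteq> (\<lambda>b. {Upper k, Upper b}) ` {b. k < b \<and> {Upper k, Upper b} \<in> T} \<union>
    (\<lambda>b. {Upper k, Upper b}) ` {b. b < k \<and> {Upper k, Upper b} \<in> T} \<union>
    (\<lambda>q. {Upper k, Lower q}) ` {q. {Upper k, Lower q} \<in> T}" (is "_ \<subseteq> ?F")
  proof
    fix u assume u: "u \<in> {u \<in> T. Upper k \<in> u}"
    then have "u \<in> strip_arcs" using arcs by blast
    then show "u \<in> ?F"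
      by (cases rule: strip_arcs_cases) (use u in \<open>auto simp: insert_commute\<close>)
  qed
  moreover have "finite ?F" using left right fin by simp
  ultimately show False using unb unfolding bounded_point_def using finite_subset by blast
qed

lemma compact_imp_admissible:
  assumes comp: "compact_triangulation T"
  shows "admissible T"
  unfolding admissible_def
proof
  fix p
  note sym = strip_symmetry_opposite
  show "bounded_point T p \<or> infinite {u \<in> T. connecting_arc u \<and> p \<in> u}"
  proof (cases p)
    case (Upper k)
    then show ?thesis using compact_unbounded_upper[OF comp, of k] infinite_connecting_iff(1) by blast
  next
    case (Lower k)
    \<comment> \<open>The half turn takes \<open>Lower k\<close> to \<open>Upper k\<close>, where
      the claim is already known.\<close>
    let ?T' = "(`) opposite ` T"
    have inj: "inj ((`) opposite)" by (rule injI) (metis strip_symmetryD(2)[OF sym])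
    have "{u \<in> ?T'. Upper k \<in> u} = (`) opposite ` {u \<in> T. Lower k \<in> u}"
    proof -
      have "Upper k \<in> opposite ` u \<longleftrightarrow> Lower k \<in> u" for u
        by (metis image_iff opposite.simps(2) opposite_opposite)
      then show ?thesis by blast
    qed
    moreover have "finite ((`) opposite ` A) \<longleftrightarrow> finite A" for A
      by (rule finite_image_iff) (rule inj_on_subset[OF inj subset_UNIV])
    ultimately have "bounded_point ?T' (Upper k) \<longleftrightarrow> bounded_point T p"
      unfolding bounded_point_def Lower by simp
    moreover have "{q. {Upper k, Lower q} \<in> ?T'} = {q. {Upper q, Lower k} \<in> T}"
      unfolding strip_symmetryD(4)[OF sym] opposite_pair ..
    ultimately show ?thesis
      using compact_unbounded_upper[OF strip_symmetry_compact_triangulation[OF sym comp], of k]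
      unfolding Lower infinite_connecting_iff(2) by auto
  qed
qed

theorem theorem5p20:
  fixes T :: "marked_point set set"
  assumes "strip_triangulation T"
  shows "compact_triangulation T \<longleftrightarrow>
    (\<exists>u \<in> T. connecting_arc u) \<and>
    (\<forall>p. bounded_point T p \<or> infinite {u \<in> T. connecting_arc u \<and> p \<in> u})"
  using compact_connecting_arc compact_imp_admissible compact_if_admissible[OF assms]
  unfolding admissible_def[symmetric] by blast

end
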